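(* Consider the spectral curve $xy^2=1$, given parametrically by $x(z)=z^2$ and $y(z)=\frac1z$ on $\mathbb{CP}^1$. For every integer $g\ge 0$, its $1$-point topological recursion invariant is $$\omega^g_1(z)=2^{1-8g}\,\frac{(2g)!^3}{g!^4\,(2g-1)}\,z^{-2g}\,\mathrm{d}z.$$
   Context: **Topological recursion.** Let $x(z),y(z)$ be rational functions on $\mathbb{CP}^1$ (with rational parameter $z$) such that the zeros of $\mathrm{d}x$ are simple ($y$ is allowed to have a simple pole at a zero of $\mathrm{d}x$). For $z$ near a zero $\alpha$ of $\mathrm{d}x$ let $\hat z\ne z$ be the unique point near $\alpha$ with $x(\hat z)=x(z)$. Define $$\omega^0_1=-y(z)\,\mathrm{d}x(z),\qquad \omega^0_2(z_1,z_2)=\frac{\mathrm{d}z_1\otimes \mathrm{d}z_2}{(z_1-z_2)^2},$$ and for $2g-2+n>0$, with $S=\{2,\ldots,n\}$, $z_I=(z_i)_{i\in I}$ and $\omega^{-1}_n=0$, $$\omega^g_n(z_1,z_S)=\sum_{\alpha}\mathop{\mathrm{Res}}_{z=\alpha}K(z_1,z)\Big[\omega^{g-1}_{n+1}(z,\hat z,z_S)+\sum_{\substack{g_1+g_2=g\\ I\sqcup J=S}}^{\circ}\omega^{g_1}_{|I|+1}(z,z_I)\,\omega^{g_2}_{|J|+1}(\hat z,z_J)\Big],$$ where the outer sum is over the zeros $\alpha$ of $\mathrm{d}x$ (here only $z=0$, with $\hat z=-z$), the symbol $\circ$ means that terms involving $\omega^0_1$ are excluded, and $$K(z_1,z)=\frac{-\int_{\hat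 z}^{z}\omega^0_2(z_1,z')}{2[y(z)-y(\hat z)]\,\mathrm{d}x(z)}=\frac{1}{2[y(z)-y(\hat z)]\,x'(z)}\Big(\frac1{z-z_1}-\frac1{\hat z-z_1}\Big)\frac{\mathrm{d}z_1}{\mathrm{d}z}.$$ *)

theory Defs
  imports "HOL-Complex_Analysis.Complex_Analysis"
begin

text \<open>
  Topological recursion for a genus zero spectral curve, given by rational functions \<open>x\<close> and \<open>y\<close>
  of an affine coordinate \<open>z\<close>, where the zeros of \<open>dx\<close> are simple.

  Only finite zeros of \<open>dx\<close> are taken into account, so the definitions below are meant for curves
  for which \<open>dx\<close> does not vanish at infinity. (For \<open>x = z\<^sup>2\<close>, infinity is a pole of \<open>dx\<close>.)
  The analyticity condition excludes the poles of \<open>x\<close>, where \<^const>\<open>deriv\<close> is meaningless.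
\<close>

definition ramification_points :: "(complex \<Rightarrow> complex) \<Rightarrow> complex set" where
  "ramification_points x = {\<alpha>. x analytic_on {\<alpha>} \<and> deriv x \<alpha> = 0}"

text \<open>
  The local involution at a simple zero \<open>\<alpha>\<close> of \<open>dx\<close> is unique only as a germ at \<open>\<alpha>\<close>; it is used
  below only inside residues at \<open>\<alpha>\<close>, which depend only on that germ.
\<close>

definition is_local_involution :: "(complex \<Rightarrow> complex) \<Rightarrow> complex \<Rightarrow> (complex \<Rightarrow> complex) \<Rightarrow> bool" where
  "is_local_involution x \<alpha> s \<longleftrightarrow>
     s analytic_on {\<alpha>} \<and> s \<alpha> = \<alpha> \<and> (\<forall>\<^sub>F z in at \<alpha>. s z \<noteq> z \<and> x (s z) = x z)"

definition local_involution :: "(complex \<Rightarrow> complex) \<Rightarrow> complex \<Rightarrow> complex \<Rightarrow> complex" where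
  "local_involution x \<alpha> = (SOME s. is_local_involution x \<alpha> s)"

text \<open>
  Differentials are represented by their coefficients with respect to the coordinate \<open>z\<close>.
  The kernel is the coefficient of \<open>dz\<^sub>1 / dz\<close>, with \<open>s\<close> the local involution.
\<close>

definition recursion_kernel ::
  "(complex \<Rightarrow> complex) \<Rightarrow> (complex \<Rightarrow> complex) \<Rightarrow> (complex \<Rightarrow> complex) \<Rightarrow> complex \<Rightarrow> complex \<Rightarrow> complex" where
  "recursion_kernel x y s z1 z =
     1 / (2 * (y z - y (s z)) * deriv x z) * (1 / (z - z1) - 1 / (s z - z1))"

text \<open>
  The indices \<open>(g\<^sub>1, I, g\<^sub>2, J)\<close> of the terms \<open>\<omega>\<^sup>g\<^sup>1(z, z\<^sub>I) \<omega>\<^sup>g\<^sup>2(s z, z\<^sub>J)\<close> not involving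
  \<open>\<omega>\<^sup>0\<^sub>1\<close>. The \<open>m\<close> variables \<open>z\<^sub>S\<close> form a list, and \<open>S\<close> is its set of positions \<open>{..<m}\<close>.
\<close>

definition splittings :: "nat \<Rightarrow> nat \<Rightarrow> (nat \<times> nat set \<times> nat \<times> nat set) set" where
  "splittings g m = {(g1, I, g2, J). g1 + g2 = g \<and> I \<union> J = {..<m} \<and> I \<inter> J = {} \<and>
     (g1, I) \<noteq> (0, {}) \<and> (g2, J) \<noteq> (0, {})}"

text \<open>
  \<open>TR x y g z1 zs\<close> is the coefficient of \<open>dz\<^sub>1 \<dots> dz\<^sub>n\<close> in \<open>\<omega>\<^sup>g\<^sub>n(z\<^sub>1, \<dots>, z\<^sub>n)\<close>, where \<open>zs\<close>
  lists \<open>z\<^sub>2, \<dots>, z\<^sub>n\<close>, so \<open>n = length zs + 1\<close>. In every term of the bracket exactly one slot is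
  evaluated at \<open>s z\<close>; pulling back its differential gives the factor \<^term>\<open>deriv s z\<close>.
\<close>

function TR ::
  "(complex \<Rightarrow> complex) \<Rightarrow> (complex \<Rightarrow> complex) \<Rightarrow> nat \<Rightarrow> complex \<Rightarrow> complex list \<Rightarrow> complex" where
  "TR x y g z1 zs =
     (if g = 0 \<and> length zs = 0 then - y z1 * deriv x z1
      else if g = 0 \<and> length zs = 1 then 1 / (z1 - hd zs)\<^sup>2
      else (\<Sum>\<alpha>\<in>ramification_points x.
        residue (\<lambda>z.
          recursion_kernel x y (local_involution x \<alpha>) z1 z *
          ((if g = 0 then 0 else TR x y (g - 1) z (local_involution x \<alpha> z # zs)) +
           (\<Sum>(g1, I, g2, J)\<in>splittings g (length zs).
              TR x y g1 z (nths zs I) * TR x y g2 (local_involution x \<alpha> z) (nths zs J))) *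
          deriv (local_involution x \<alpha>) z) \<alpha>))"
  by pat_completeness auto

lemma splittings_decrease:
  assumes "(g1, I, g2, J) \<in> splittings g (length (zs :: complex list))"
  shows "2 * g1 + length (nths zs I) < 2 * g + length zs"
    and "2 * g2 + length (nths zs J) < 2 * g + length zs"
proof -
  from assms have *: "g1 + g2 = g" "I \<union> J = {..<length zs}" "I \<inter> J = {}"
      "(g1, I) \<noteq> (0, {})" "(g2, J) \<noteq> (0, {})"
    by (auto simp: splittings_def)
  have fin: "finite I" "finite J"
    using *(2) by (metis finite_Un finite_lessThan)+
  have "{i. i < length zs \<and> i \<in> I} = I" "{i. i < length zs \<and> i \<in> J} = J"
    using *(2) by auto
  hence len: "length (nths zs I) = card I" "length (nths zs J) = card J"
    by (simp_all add: length_nths)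
  have "card I + card J = length zs"
    using card_Un_disjoint[OF fin *(3)] *(2) by simp
  moreover have "g1 > 0 \<or> card I > 0" "g2 > 0 \<or> card J > 0"
    using *(4,5) fin by (auto simp: card_gt_0_iff)
  ultimately show "2 * g1 + length (nths zs I) < 2 * g + length zs"
      and "2 * g2 + length (nths zs J) < 2 * g + length zs"
    unfolding len using *(1) by linarith+
qed

termination
  by (relation "Wellfounded.measure (\<lambda>(x, y, g, z1, zs). 2 * g + length zs)")
     (auto dest: splittings_decrease)

declare TR.simps [simp del]

text \<open>
  Consistency checks for \<open>x = z\<^sup>2\<close>: there is one ramification point, it is a simple zero of \<open>dx\<close>,
  and the local involution there is the germ of \<open>z \<mapsto> - z\<close>.
\<close>

lemma ramification_points_square: "ramification_points (\<lambda>z. z\<^sup>2) = {0}"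
proof -
  have "deriv (\<lambda>z::complex. z\<^sup>2) \<alpha> = 2 * \<alpha>" for \<alpha>
    by (rule DERIV_imp_deriv) (auto intro!: derivative_eq_intros)
  thus ?thesis
    by (auto simp: ramification_points_def intro!: analytic_intros)
qed

lemma deriv_deriv_square: "deriv (deriv (\<lambda>z::complex. z\<^sup>2)) 0 \<noteq> 0"
proof -
  have "deriv (\<lambda>z::complex. z\<^sup>2) = (\<lambda>z. 2 * z)"
    by (rule ext, rule DERIV_imp_deriv) (auto intro!: derivative_eq_intros)
  moreover have "deriv (\<lambda>z::complex. 2 * z) 0 = 2"
    by (rule DERIV_imp_deriv) (auto intro!: derivative_eq_intros)
  ultimately show ?thesis by simp
qed

lemma local_involution_square:
  "is_local_involution (\<lambda>z. z\<^sup>2) 0 (local_involution (\<lambda>z. z\<^sup>2) 0)"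
  "\<forall>\<^sub>F z in at 0. local_involution (\<lambda>z. z\<^sup>2) 0 z = - z"
proof -
  have "is_local_involution (\<lambda>z. z\<^sup>2) 0 uminus"
    unfolding is_local_involution_def
    by (auto simp: eventually_at_filter intro!: analytic_intros always_eventually)
  thus *: "is_local_involution (\<lambda>z. z\<^sup>2) 0 (local_involution (\<lambda>z. z\<^sup>2) 0)"
    unfolding local_involution_def by (rule someI[where P = "is_local_involution (\<lambda>z. z\<^sup>2) 0"])
  hence "\<forall>\<^sub>F z in at 0. local_involution (\<lambda>z. z\<^sup>2) 0 z \<noteq> z \<and> (local_involution (\<lambda>z. z\<^sup>2) 0 z)\<^sup>2 = z\<^sup>2"
    by (simp add: is_local_involution_def)
  thus "\<forall>\<^sub>F z in at 0. local_involution (\<lambda>z. z\<^sup>2) 0 z = - z"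
    by eventually_elim (auto simp: power2_eq_iff)
qed

end

theory Submission
  imports Defs "HOL-Library.Multiset"
begin

text \<open>
  Every \<open>\<omega>\<^sup>g\<^sub>n\<close> with \<open>g > 0\<close> is a polynomial in the \<open>1 / z\<^sub>i\<^sup>2\<close>, and topological recursion is a quadratic
  recursion for its coefficients. Exponentiating turns this recursion into the linear Virasoro
  constraints of the Brezin-Gross-Witten tau function. The Virasoro commutation relations show that
  the exponentiated coefficients are symmetric in all arguments. Combining the symmetry of
  the three-point coefficients with the constraints for the one- and two-point coefficients yields a
  first-order recursion in \<open>g\<close> for the one-point coefficients, which the closed formula solves.
  In the language of conformal field theory this is the null vector at level three of the primary
  field of weight one.
\<close>

subsection \<open>Sums over splittings of a list\<close>

text \<open>Because \<open>y\<close> has a pole at 0, the kernel times the pullback factor is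
  \<open>z / (4 * (z1\<^sup>2 - z\<^sup>2))\<close>, which is odd and vanishes at 0. Hence genus 0
  contributes only through omega^0_2, and all constants come from two residues: 1/4 from the kernel
  against an even power, and 2 (2 a + 1) from the sum of omega^0_2 at z and -z. The one source term
  is omega^0_2(z, -z) = 1 / (4 z^2), which gives 1/16 in genus 1. The obstacle is that the recursion
  does not close: one-point coefficients call two-point ones, these call three-point ones, and so
  on. Three points suffice because a sum over triples with weight 3 b - (M - 1) is killed by
  symmetrisation, whatever the coefficients are. Symmetry itself is hidden, since the recursion
  singles out its first argument, and its quadratic terms stand in the way of a commutator argument;
  hence the exponentiation. The value 1/16 finally makes a quadratic factor the perfect square (m +
  3/2)^2, so that the solution is a quotient of factorials.\<close>

fun splits :: "'a list \<Rightarrow> ('a list \<times> 'a list) list" where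
  "splits [] = [([], [])]"
| "splits (x # xs) = map (\<lambda>(u, v). (x # u, v)) (splits xs) @ map (\<lambda>(u, v). (u, x # v)) (splits xs)"

fun picks :: "'a list \<Rightarrow> ('a \<times> 'a list) list" where
  "picks [] = []"
| "picks (x # xs) = (x, xs) # map (\<lambda>(a, v). (a, x # v)) (picks xs)"

text \<open>Positions are split, not values, so multiplicities are counted. The list form turns
  identities between sums over subsets into inductions; \<open>split_sum_Pow\<close> gives the link
  to sets of positions.\<close>

definition split_sum :: "('a list \<Rightarrow> 'a list \<Rightarrow> 'b::comm_semiring_0) \<Rightarrow> 'a list \<Rightarrow> 'b" where
  "split_sum h xs = (\<Sum>(u, v)\<leftarrow>splits xs. h u v)"

definition pick_sum :: "('a \<Rightarrow> 'a list \<Rightarrow> 'b::comm_semiring_0) \<Rightarrow> 'a list \<Rightarrow> 'b" where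
  "pick_sum h xs = (\<Sum>(a, v)\<leftarrow>picks xs. h a v)"

lemma split_sum_simps [simp]:
  "split_sum h [] = h [] []"
  "split_sum h (x # xs) = split_sum (\<lambda>u. h (x # u)) xs + split_sum (\<lambda>u v. h u (x # v)) xs"
  by (simp_all add: split_sum_def o_def case_prod_unfold)

lemma pick_sum_simps [simp]:
  "pick_sum h [] = 0"
  "pick_sum h (x # xs) = h x xs + pick_sum (\<lambda>a v. h a (x # v)) xs"
  by (simp_all add: pick_sum_def o_def case_prod_unfold)

lemma splits_mset: "(u, v) \<in> set (splits xs) \<Longrightarrow> mset xs = mset u + mset v"
  by (induction xs arbitrary: u v) auto

lemma picks_mset: "(a, v) \<in> set (picks xs) \<Longrightarrow> mset xs = add_mset a (mset v)"
  by (induction xs arbitrary: a v) auto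

lemma splits_length: "(u, v) \<in> set (splits xs) \<Longrightarrow> length xs = length u + length v"
  by (metis splits_mset size_mset size_union)

lemma picks_length: "(a, v) \<in> set (picks xs) \<Longrightarrow> length xs = Suc (length v)"
  by (metis picks_mset size_mset size_add_mset)

lemma splits_sum_list:
  "(u, v) \<in> set (splits xs) \<Longrightarrow> sum_list xs = sum_list u + sum_list (v :: 'a::comm_monoid_add list)"
  by (metis splits_mset sum_mset_sum_list sum_mset.union)

lemma picks_sum_list:
  "(a, v) \<in> set (picks xs) \<Longrightarrow> sum_list xs = a + sum_list (v :: 'a::comm_monoid_add list)"
  by (metis picks_mset sum_mset_sum_list sum_mset.add_mset)

lemma splits_weight:
  "(u, v) \<in> set (splits xs) \<Longrightarrow> length xs = length u + length v \<and>
     sum_list xs = sum_list u + sum_list (v :: 'a::comm_monoid_add list)"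
  by (simp add: splits_length splits_sum_list)

lemma picks_weight:
  "(a, v) \<in> set (picks xs) \<Longrightarrow> length xs = Suc (length v) \<and>
     sum_list xs = a + sum_list (v :: 'a::comm_monoid_add list)"
  by (simp add: picks_length picks_sum_list)

lemma splits_set: "(u, v) \<in> set (splits xs) \<Longrightarrow> set xs = set u \<union> set v"
  by (metis splits_mset set_mset_mset set_mset_union)

lemma split_sum_cong:
  "(\<And>u v. (u, v) \<in> set (splits xs) \<Longrightarrow> h u v = h' u v) \<Longrightarrow> split_sum h xs = split_sum h' xs"
  unfolding split_sum_def by (intro arg_cong[where f = sum_list] map_cong) auto

lemma pick_sum_cong:
  "(\<And>a v. (a, v) \<in> set (picks xs) \<Longrightarrow> h a v = h' a v) \<Longrightarrow> pick_sum h xs = pick_sum h' xs"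
  unfolding pick_sum_def by (intro arg_cong[where f = sum_list] map_cong) auto

lemma split_sum_add: "split_sum (\<lambda>u v. f u v + g u v) xs = split_sum f xs + split_sum g xs"
  by (induction xs arbitrary: f g) (auto simp: algebra_simps)

lemma split_sum_zero: "split_sum (\<lambda>u v. 0) xs = 0"
  by (induction xs) auto

lemma split_sum_cmult: "split_sum (\<lambda>u v. c * f u v) xs = c * split_sum f xs"
  by (induction xs arbitrary: f) (auto simp: algebra_simps)

lemma split_sum_sum: "split_sum (\<lambda>u v. \<Sum>i\<in>I. f i u v) xs = (\<Sum>i\<in>I. split_sum (f i) xs)"
  by (induction xs arbitrary: f) (auto simp: sum.distrib)

lemma pick_sum_add: "pick_sum (\<lambda>u v. f u v + g u v) xs = pick_sum f xs + pick_sum g xs"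
  by (induction xs arbitrary: f g) (auto simp: algebra_simps)

lemma pick_sum_cmult: "pick_sum (\<lambda>u v. c * f u v) xs = c * pick_sum f xs"
  by (induction xs arbitrary: f) (auto simp: algebra_simps)

lemma pick_sum_sum: "pick_sum (\<lambda>u v. \<Sum>i\<in>I. f i u v) xs = (\<Sum>i\<in>I. pick_sum (f i) xs)"
  by (induction xs arbitrary: f) (auto simp: sum.distrib)

text \<open>Coassociativity of the unshuffle coproduct: both sides run over the distributions of the
  entries into three ordered sublists.\<close>

lemma split_sum_assoc:
  "split_sum (\<lambda>u v. split_sum (h u) v) xs = split_sum (\<lambda>u v. split_sum (\<lambda>p q. h p q v) u) xs"
  by (induction xs arbitrary: h) (simp_all add: split_sum_add add.assoc)

lemma split_sum_commute: "split_sum h xs = split_sum (\<lambda>u v. h v u) xs"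
proof (induction xs arbitrary: h)
  case (Cons x xs)
  show ?case
    using Cons.IH[of "\<lambda>u. h (x # u)"] Cons.IH[of "\<lambda>u v. h u (x # v)"] by (simp add: add.commute)
qed simp

text \<open>Picking is splitting off one entry, so this is coassociativity with a singleton as first
  part.\<close>

lemma pick_sum_split_sum:
  "pick_sum (\<lambda>a. split_sum (h a)) xs = split_sum (\<lambda>u v. pick_sum (\<lambda>a p. h a p v) u) xs"
  by (induction xs arbitrary: h) (simp_all add: split_sum_add pick_sum_add algebra_simps)

lemma split_sum_Nil_left: "(\<And>u v. u \<noteq> [] \<Longrightarrow> h u v = 0) \<Longrightarrow> split_sum h xs = h [] xs"
proof (induction xs arbitrary: h)
  case (Cons x xs)
  show ?case
    using Cons.IH[of "\<lambda>u v. h u (x # v)"] Cons.prems[of "x # _"] Cons.prems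
    by (simp add: split_sum_cong[of xs "\<lambda>u. h (x # u)" "\<lambda>u v. 0"] split_sum_zero)
qed simp

text \<open>Meant for a factor omega^0_2, which carries exactly one of the remaining
  variables.\<close>

lemma split_sum_singleton_left:
  "(\<And>u v. length u \<noteq> 1 \<Longrightarrow> h u v = 0) \<Longrightarrow> split_sum h xs = pick_sum (\<lambda>a. h [a]) xs"
proof (induction xs arbitrary: h)
  case (Cons x xs)
  show ?case
    using Cons.IH[of "\<lambda>u v. h u (x # v)"]
    by (simp add: Cons.prems split_sum_Nil_left[of "\<lambda>u. h (x # u)"])
qed simp

subsection \<open>Connected and disconnected correlators\<close>

text \<open>
  \<open>conn [k\<^sub>1, \<dots>, k\<^sub>n]\<close> is the coefficient of \<open>\<Prod> z\<^sub>i powi (- 2 * k\<^sub>i - 2)\<close> in \<open>\<omega>\<^sup>g\<^sub>n\<close>.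
  By homogeneity it can only be nonzero for \<open>g = 1 + k\<^sub>1 + \<dots> + k\<^sub>n\<close>, so the genus need not be recorded.
\<close>

function conn :: "nat list \<Rightarrow> complex" where
  "conn [] = 0"
| "conn (k # ks) =
     ((\<Sum>i<k. conn (i # (k - 1 - i) # ks) +
         (\<Sum>(u, v)\<leftarrow>splits ks. conn (i # u) * conn ((k - 1 - i) # v))) +
      (\<Sum>(a, v)\<leftarrow>picks ks. 2 * (2 * of_nat a + 1) * conn ((k + a) # v))) / 4 +
     (if k = 0 \<and> ks = [] then 1 / 16 else 0)"
  by pat_completeness auto
termination
  by (relation "Wellfounded.measure (\<lambda>ks. 2 * sum_list ks + length ks)")
     (auto dest!: splits_weight picks_weight)

declare conn.simps(2) [simp del]

lemma conn_Cons:
  "conn (k # ks) =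
     ((\<Sum>i<k. conn (i # (k - 1 - i) # ks) +
         split_sum (\<lambda>u v. conn (i # u) * conn ((k - 1 - i) # v)) ks) +
      pick_sum (\<lambda>a v. 2 * (2 * of_nat a + 1) * conn ((k + a) # v)) ks) / 4 +
     (if k = 0 \<and> ks = [] then 1 / 16 else 0)"
  unfolding split_sum_def pick_sum_def by (rule conn.simps(2))

text \<open>
  The disconnected correlators, the coefficients of the exponential of the generating function of
  \<^const>\<open>conn\<close>. Their recursion is linear.
\<close>

function disc :: "nat list \<Rightarrow> complex" where
  "disc [] = 1"
| "disc (k # ks) = (\<Sum>(u, v)\<leftarrow>splits ks. conn (k # u) * disc v)"
  by pat_completeness auto
termination
  by (relation "Wellfounded.measure length") (auto dest!: splits_length)

declare disc.simps(2) [simp del]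

lemma disc_Cons: "disc (k # ks) = split_sum (\<lambda>u v. conn (k # u) * disc v) ks"
  unfolding split_sum_def by (rule disc.simps(2))

text \<open>The first two arguments lie in one connected component or in two; \<open>u\<close>
  collects the companions of both. The inner sum is the bracket of \<open>conn_Cons\<close>, which
  is why the quadratic term becomes linear for \<open>disc\<close>.\<close>

lemma disc_Cons_Cons:
  "disc (i # j # ks) = split_sum (\<lambda>u v. (conn (i # j # u) +
     split_sum (\<lambda>p q. conn (i # p) * conn (j # q)) u) * disc v) ks"
proof -
  have "split_sum (\<lambda>u v. conn (i # u) * disc (j # v)) ks =
      split_sum (\<lambda>u. split_sum (\<lambda>p q. conn (i # u) * (conn (j # p) * disc q))) ks"
    unfolding disc_Cons split_sum_cmult ..
  also have "\<dots> = split_sum (\<lambda>u v. split_sum (\<lambda>p q. disc v * (conn (i # p) * conn (j # q))) u) ks"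
    by (subst split_sum_assoc) (simp only: mult_ac)
  finally have "split_sum (\<lambda>u v. conn (i # u) * disc (j # v)) ks =
      split_sum (\<lambda>u v. split_sum (\<lambda>p q. conn (i # p) * conn (j # q)) u * disc v) ks"
    by (simp only: split_sum_cmult mult.commute)
  thus ?thesis
    by (subst disc_Cons) (simp add: distrib_right split_sum_add)
qed

text \<open>Apply \<open>conn_Cons\<close> to the component that contains \<open>k\<close> and leave
  the others alone. The constant occurs only if \<open>k\<close> is a component by itself, so it
  multiplies \<open>disc ks\<close>.\<close>

lemma disc_recursion:
  "disc (k # ks) =
     ((\<Sum>i<k. disc (i # (k - 1 - i) # ks)) +
      pick_sum (\<lambda>a v. 2 * (2 * of_nat a + 1) * disc ((k + a) # v)) ks) / 4 +
     (if k = 0 then disc ks / 16 else 0)"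
proof -
  define D where "D = (\<lambda>u. pick_sum (\<lambda>a v. 2 * (2 * of_nat a + 1) * conn ((k + a) # v)) u)"
  define Q where "Q = (\<lambda>i u. conn (i # (k - 1 - i) # u) +
         split_sum (\<lambda>p q. conn (i # p) * conn ((k - 1 - i) # q)) u)"
  have D: "pick_sum (\<lambda>a v. 2 * (2 * of_nat a + 1) * disc ((k + a) # v)) ks =
      split_sum (\<lambda>u v. D u * disc v) ks"
  proof -
    have "pick_sum (\<lambda>a v. 2 * (2 * of_nat a + 1) * disc ((k + a) # v)) ks =
        pick_sum (\<lambda>a. split_sum (\<lambda>p q. disc q * (2 * (2 * of_nat a + 1) * conn ((k + a) # p)))) ks"
      by (simp add: disc_Cons split_sum_cmult[symmetric] mult_ac)
    also have "\<dots> = split_sum (\<lambda>u v. disc v * D u) ks"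
      by (simp add: pick_sum_split_sum pick_sum_cmult D_def)
    finally show ?thesis by (simp add: mult.commute)
  qed
  have E: "split_sum (\<lambda>u v. (if k = 0 \<and> u = [] then 1 / 16 else 0) * disc v) ks =
      (if k = 0 then disc ks / 16 else 0)"
    by (subst split_sum_Nil_left) auto
  have C: "conn (k # u) = ((\<Sum>i<k. Q i u) + D u) / 4 + (if k = 0 \<and> u = [] then 1 / 16 else 0)" for u
    unfolding D_def Q_def by (rule conn_Cons)
  have "disc (k # ks) = split_sum (\<lambda>u v. (1 / 4) * (\<Sum>i<k. Q i u * disc v) + (1 / 4) * (D u * disc v) +
      (if k = 0 \<and> u = [] then 1 / 16 else 0) * disc v) ks"
    unfolding disc_Cons C sum_distrib_right[symmetric]
    by (intro split_sum_cong) (simp add: ring_distribs add_divide_distrib del: mult_eq_0_iff)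
  also have "\<dots> = (1 / 4) * (\<Sum>i<k. split_sum (\<lambda>u v. Q i u * disc v) ks) +
     (1 / 4) * split_sum (\<lambda>u v. D u * disc v) ks + (if k = 0 then disc ks / 16 else 0)"
    by (simp only: split_sum_add split_sum_cmult split_sum_sum E)
  also have "(\<Sum>i<k. split_sum (\<lambda>u v. Q i u * disc v) ks) = (\<Sum>i<k. disc (i # (k - 1 - i) # ks))"
    by (simp add: disc_Cons_Cons Q_def)
  finally show ?thesis unfolding D by (simp add: add_divide_distrib)
qed

subsection \<open>Symmetry from the Virasoro relations\<close>

text \<open>The two sums glue to one over p < a + b with weight 2 (p - b) + 1. As \<open>f\<close>
  is symmetric under reflection, p may be replaced by its mean (a + b - 1) / 2, and the weight
  becomes a - b. In the commutator this is the action of the first-order part on the quadratic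
  part.\<close>

lemma virasoro_boundary:
  fixes f :: "nat \<Rightarrow> complex"
  assumes sym: "\<And>p. p < a + b \<Longrightarrow> f (a + b - 1 - p) = f p"
  shows "(\<Sum>i<a. (2 * of_nat i + 1) * f (b + i)) - (\<Sum>i<b. (2 * of_nat i + 1) * f (a + i)) =
         (of_nat a - of_nat b) * (\<Sum>p<a + b. f p)"
proof -
  let ?N = "a + b"
  have 1: "(\<Sum>i<a. (2 * of_nat i + 1) * f (b + i)) = (\<Sum>p\<in>{b..<?N}. (2 * (of_nat p - of_nat b) + 1) * f p)"
    by (rule sum.reindex_bij_witness[of _ "\<lambda>p. p - b" "\<lambda>i. b + i"]) auto
  \<comment> \<open>The reflection carries \<open>a + i\<close> to \<open>b - 1 - i\<close>; there
    the weight of the glued sum is negative, which accounts for the minus sign in front of the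
    second sum.\<close>
  have 2: "(\<Sum>i<b. (2 * of_nat i + 1) * f (a + i)) = (\<Sum>p\<in>{..<b}. - (2 * (of_nat p - of_nat b) + 1) * f p)"
  proof (rule sum.reindex_bij_witness[of _ "\<lambda>p. b - 1 - p" "\<lambda>i. b - 1 - i"])
    fix i assume i: "i \<in> {..<b}"
    have "f (b - 1 - i) = f (a + i)"
      using sym[of "a + i"] i by (simp add: algebra_simps)
    thus "- (2 * (of_nat (b - 1 - i) - of_nat b) + 1) * f (b - 1 - i) = (2 * of_nat i + 1) * f (a + i)"
      using i by (simp add: of_nat_diff algebra_simps)
  qed auto
  have 3: "(\<Sum>p<?N. of_nat p * f p) = (\<Sum>p<?N. of_nat (?N - 1 - p) * f p)"
    using sum.nat_diff_reindex[of "\<lambda>p. of_nat p * f p" ?N] sym by simp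
  have "2 * (\<Sum>p<?N. of_nat p * f p) = (\<Sum>p<?N. of_nat p * f p) + (\<Sum>p<?N. of_nat (?N - 1 - p) * f p)"
    using 3 by simp
  also have "\<dots> = (\<Sum>p<?N. (of_nat ?N - 1) * f p)"
    unfolding sum.distrib[symmetric]
    by (intro sum.cong) (auto simp: of_nat_diff algebra_simps)
  finally have 4: "2 * (\<Sum>p<?N. of_nat p * f p) = (of_nat ?N - 1) * (\<Sum>p<?N. f p)"
    by (simp add: sum_distrib_left)
  have "(\<Sum>i<a. (2 * of_nat i + 1) * f (b + i)) - (\<Sum>i<b. (2 * of_nat i + 1) * f (a + i)) =
     (\<Sum>p<?N. (2 * (of_nat p - of_nat b) + 1) * f p)"
  proof -
    have "{..<?N} = {..<b} \<union> {b..<?N}" by auto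
    hence "(\<Sum>p<?N. (2 * (of_nat p - of_nat b) + 1) * f p) = (\<Sum>p\<in>{..<b}. (2 * (of_nat p - of_nat b) + 1) * f p) +
       (\<Sum>p\<in>{b..<?N}. (2 * (of_nat p - of_nat b) + 1) * f p)"
      by (simp add: sum.union_disjoint ivl_disj_int)
    thus ?thesis unfolding 1 2 by (simp only: minus_mult_left[symmetric] sum_negf) simp
  qed
  also have "\<dots> = 2 * (\<Sum>p<?N. of_nat p * f p) + (\<Sum>p<?N. (1 - 2 * of_nat b) * f p)"
    unfolding sum_distrib_left sum.distrib[symmetric]
    by (intro sum.cong) (auto simp: algebra_simps)
  also have "\<dots> = (of_nat a - of_nat b) * (\<Sum>p<?N. f p)"
    unfolding 4 sum_distrib_left[symmetric] by (simp add: algebra_simps)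
  finally show ?thesis .
qed

section \<open>Multiset functions and the Virasoro operators on them\<close>

definition mpick_sum :: "('a \<Rightarrow> 'a multiset \<Rightarrow> 'b::comm_semiring_0) \<Rightarrow> 'a multiset \<Rightarrow> 'b" where
  "mpick_sum h M = (\<Sum>a\<in>#M. h a (M - {#a#}))"

lemma mpick_sum_empty [simp]: "mpick_sum h {#} = 0"
  by (simp add: mpick_sum_def)

lemma mpick_sum_add_mset [simp]:
  "mpick_sum h (add_mset c M) = h c M + mpick_sum (\<lambda>a N. h a (add_mset c N)) M"
proof -
  have "(\<Sum>a\<in>#M. h a (add_mset c M - {#a#})) = (\<Sum>a\<in>#M. h a (add_mset c (M - {#a#})))"
    by (intro arg_cong[where f = sum_mset] image_mset_cong) (auto simp: multiset_eq_iff)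
  thus ?thesis by (simp add: mpick_sum_def)
qed

lemma mpick_sum_cong:
  "(\<And>a N. M = add_mset a N \<Longrightarrow> h a N = h' a N) \<Longrightarrow> mpick_sum h M = mpick_sum h' M"
  unfolding mpick_sum_def by (intro arg_cong[where f = sum_mset] image_mset_cong) auto

lemma mpick_sum_add: "mpick_sum (\<lambda>a N. f a N + g a N) M = mpick_sum f M + mpick_sum g M"
  by (simp add: mpick_sum_def sum_mset.distrib)

lemma mpick_sum_cmult: "mpick_sum (\<lambda>a N. c * f a N) M = c * mpick_sum f M"
  by (simp add: mpick_sum_def sum_mset_distrib_left)

lemma mpick_sum_sum: "mpick_sum (\<lambda>a N. \<Sum>i\<in>I. f i a N) M = (\<Sum>i\<in>I. mpick_sum (f i) M)"
  by (induction M arbitrary: f) (auto simp: sum.distrib)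

lemma mpick_sum_swap:
  "mpick_sum (\<lambda>a. mpick_sum (h a)) M = mpick_sum (\<lambda>a. mpick_sum (\<lambda>b. h b a)) M"
proof (induction M arbitrary: h)
  case (add c M)
  show ?case
    using add.IH[of "\<lambda>a b N. h a b (add_mset c N)"] by (simp add: mpick_sum_add add_ac)
qed simp

lemma pick_sum_mset: "pick_sum (\<lambda>a v. h a (mset v)) xs = mpick_sum h (mset xs)"
proof (induction xs arbitrary: h)
  case (Cons x xs)
  show ?case using Cons.IH[of "\<lambda>a N. h a (add_mset x N)"] by simp
qed simp

text \<open>Acting on Taylor coefficients in variables t_a, the terms are second derivatives, the
  operators t_a d/dt_(k + a), and a constant in the zero mode. Multisets build in the commutation of
  partial derivatives.\<close>

definition virasoro :: "(nat multiset \<Rightarrow> complex) \<Rightarrow> nat \<Rightarrow> nat multiset \<Rightarrow> complex" where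
  "virasoro Y k M =
     ((\<Sum>i<k. Y (add_mset i (add_mset (k - 1 - i) M))) +
      mpick_sum (\<lambda>a N. 2 * (2 * of_nat a + 1) * Y (add_mset (k + a) N)) M) / 4 +
     (if k = 0 then Y M / 16 else 0)"

text \<open>For a connected correlator this is 2 g - 2 + n, and it is additive over components.
  Every value of \<open>Y\<close> in \<open>virasoro Y k M\<close> has weight exactly one below that
  of \<open>add_mset k M\<close>.\<close>

definition weight :: "nat multiset \<Rightarrow> nat" where
  "weight M = 2 * \<Sum>\<^sub># M + size M"

lemma weight_add_mset [simp]: "weight (add_mset a M) = 2 * a + 1 + weight M"
  by (simp add: weight_def)

text \<open>Wherever the first operator leaves \<open>b\<close> as an argument of its quadratic or
  first-order part, \<open>b\<close> is removed by the second one. The term with \<open>w b\<close>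
  arises when the first operator absorbs \<open>b\<close>; it and the constant term for
  \<open>a = 0\<close> stay unexpanded.\<close>

lemma virasoro_twice:
  assumes rec: "\<forall>k N. weight (add_mset k N) < weight (add_mset a (add_mset b M)) \<longrightarrow>
    Y (add_mset k N) = virasoro Y k N"
    and w: "w = (\<lambda>c. 2 * (2 * of_nat c + 1))"
  shows "virasoro Y a (add_mset b M) =
    ((\<Sum>i<a. \<Sum>j<b. Y (add_mset i (add_mset (a - 1 - i) (add_mset j (add_mset (b - 1 - j) M))))) +
     (\<Sum>i<a. mpick_sum (\<lambda>s N. w s * Y (add_mset (b + s) (add_mset i (add_mset (a - 1 - i) N)))) M) +
     (\<Sum>j<b. mpick_sum (\<lambda>s N. w s * Y (add_mset (a + s) (add_mset j (add_mset (b - 1 - j) N)))) M) +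
     mpick_sum (\<lambda>s. mpick_sum (\<lambda>t N. w s * w t * Y (add_mset (a + s) (add_mset (b + t) N)))) M +
     2 * (\<Sum>i<a. w i * Y (add_mset (b + i) (add_mset (a - 1 - i) M))) +
     mpick_sum (\<lambda>s N. w s * w (a + s) * Y (add_mset (a + b + s) N)) M) / 16 +
    w b * Y (add_mset (a + b) M) / 4 +
    (if b = 0 then ((\<Sum>i<a. Y (add_mset i (add_mset (a - 1 - i) M))) +
        mpick_sum (\<lambda>s N. w s * Y (add_mset (a + s) N)) M) / 64 else 0) +
    (if a = 0 then Y (add_mset b M) / 16 else 0)"
proof -
  let ?\<delta> = "\<lambda>y. if b = 0 then y / 16 else (0::complex)"
  have T1: "Y (add_mset i (add_mset (a - 1 - i) (add_mset b M))) =
     ((\<Sum>j<b. Y (add_mset i (add_mset (a - 1 - i) (add_mset j (add_mset (b - 1 - j) M))))) +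
      (w i * Y (add_mset (b + i) (add_mset (a - 1 - i) M)) +
       w (a - 1 - i) * Y (add_mset (b + (a - 1 - i)) (add_mset i M))) +
      mpick_sum (\<lambda>s N. w s * Y (add_mset (b + s) (add_mset i (add_mset (a - 1 - i) N)))) M) / 4 +
     ?\<delta> (Y (add_mset i (add_mset (a - 1 - i) M)))" if "i < a" for i
  proof -
    have "Y (add_mset i (add_mset (a - 1 - i) (add_mset b M))) =
        Y (add_mset b (add_mset i (add_mset (a - 1 - i) M)))"
      by (simp add: add_mset_commute)
    also have "\<dots> = virasoro Y b (add_mset i (add_mset (a - 1 - i) M))"
      using that by (intro rec[rule_format]) simp
    finally show ?thesis
      by (simp add: virasoro_def w add_mset_commute add_ac)
  qed
  have T2: "Y (add_mset (a + s) (add_mset b N)) =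
     ((\<Sum>j<b. Y (add_mset (a + s) (add_mset j (add_mset (b - 1 - j) N)))) +
      w (a + s) * Y (add_mset (a + b + s) N) +
      mpick_sum (\<lambda>t K. w t * Y (add_mset (a + s) (add_mset (b + t) K))) N) / 4 +
     ?\<delta> (Y (add_mset (a + s) N))" if "M = add_mset s N" for s N
  proof -
    have "Y (add_mset (a + s) (add_mset b N)) = Y (add_mset b (add_mset (a + s) N))"
      by (simp add: add_mset_commute)
    also have "\<dots> = virasoro Y b (add_mset (a + s) N)"
      using that by (intro rec[rule_format]) simp
    finally show ?thesis
      by (simp add: virasoro_def w add_mset_commute add_ac)
  qed
  \<comment> \<open>The second operator may hit either of the two new arguments; reflection
    identifies the two sums, whence the factor 2.\<close>
  have R: "(\<Sum>i<a. w (a - 1 - i) * Y (add_mset (b + (a - 1 - i)) (add_mset i M))) =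
      (\<Sum>i<a. w i * Y (add_mset (b + i) (add_mset (a - 1 - i) M)))"
    by (rule sum.reindex_bij_witness[of _ "\<lambda>i. a - 1 - i" "\<lambda>i. a - 1 - i"]) auto
  have S1: "(\<Sum>i<a. Y (add_mset i (add_mset (a - 1 - i) (add_mset b M)))) =
     ((\<Sum>i<a. \<Sum>j<b. Y (add_mset i (add_mset (a - 1 - i) (add_mset j (add_mset (b - 1 - j) M))))) +
      2 * (\<Sum>i<a. w i * Y (add_mset (b + i) (add_mset (a - 1 - i) M))) +
      (\<Sum>i<a. mpick_sum (\<lambda>s N. w s * Y (add_mset (b + s) (add_mset i (add_mset (a - 1 - i) N)))) M)) / 4 +
     ?\<delta> (\<Sum>i<a. Y (add_mset i (add_mset (a - 1 - i) M)))"
  proof -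
    have "(\<Sum>i<a. Y (add_mset i (add_mset (a - 1 - i) (add_mset b M)))) = (\<Sum>i<a.
     ((\<Sum>j<b. Y (add_mset i (add_mset (a - 1 - i) (add_mset j (add_mset (b - 1 - j) M))))) +
      (w i * Y (add_mset (b + i) (add_mset (a - 1 - i) M)) +
       w (a - 1 - i) * Y (add_mset (b + (a - 1 - i)) (add_mset i M))) +
      mpick_sum (\<lambda>s N. w s * Y (add_mset (b + s) (add_mset i (add_mset (a - 1 - i) N)))) M) / 4 +
     ?\<delta> (Y (add_mset i (add_mset (a - 1 - i) M))))"
      by (intro sum.cong refl T1) auto
    also have "\<dots> = (\<Sum>i<a.
     ((\<Sum>j<b. Y (add_mset i (add_mset (a - 1 - i) (add_mset j (add_mset (b - 1 - j) M))))) +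
      (w i * Y (add_mset (b + i) (add_mset (a - 1 - i) M)) +
       w (a - 1 - i) * Y (add_mset (b + (a - 1 - i)) (add_mset i M))) +
      mpick_sum (\<lambda>s N. w s * Y (add_mset (b + s) (add_mset i (add_mset (a - 1 - i) N)))) M)) / 4 +
     ?\<delta> (\<Sum>i<a. Y (add_mset i (add_mset (a - 1 - i) M)))"
      by (cases "b = 0") (simp_all add: sum.distrib sum_divide_distrib[symmetric])
    finally show ?thesis
      unfolding sum.distrib R mult_2 .
  qed
  have "mpick_sum (\<lambda>s N. w s * Y (add_mset (a + s) (add_mset b N))) M =
     mpick_sum (\<lambda>s N. (1 / 4) * (\<Sum>j<b. w s * Y (add_mset (a + s) (add_mset j (add_mset (b - 1 - j) N)))) +
      (1 / 4) * (w s * w (a + s) * Y (add_mset (a + b + s) N)) +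
      (1 / 4) * mpick_sum (\<lambda>t K. w s * w t * Y (add_mset (a + s) (add_mset (b + t) K))) N +
      (if b = 0 then 1 / 16 else 0) * (w s * Y (add_mset (a + s) N))) M"
    by (intro mpick_sum_cong, subst T2)
       (auto simp: mult.assoc mpick_sum_cmult sum_distrib_left[symmetric] ring_distribs add_divide_distrib)
  also have "\<dots> = (1 / 4) * (\<Sum>j<b. mpick_sum (\<lambda>s N. w s * Y (add_mset (a + s) (add_mset j (add_mset (b - 1 - j) N)))) M) +
      (1 / 4) * mpick_sum (\<lambda>s N. w s * w (a + s) * Y (add_mset (a + b + s) N)) M +
      (1 / 4) * mpick_sum (\<lambda>s. mpick_sum (\<lambda>t K. w s * w t * Y (add_mset (a + s) (add_mset (b + t) K)))) M +
      (if b = 0 then 1 / 16 else 0) * mpick_sum (\<lambda>s N. w s * Y (add_mset (a + s) N)) M"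
    by (simp only: mpick_sum_add mpick_sum_cmult mpick_sum_sum)
  finally have S2: "mpick_sum (\<lambda>s N. w s * Y (add_mset (a + s) (add_mset b N))) M = \<dots>" .
  have V: "virasoro Y a (add_mset b M) =
    ((\<Sum>i<a. Y (add_mset i (add_mset (a - 1 - i) (add_mset b M)))) + w b * Y (add_mset (a + b) M) +
     mpick_sum (\<lambda>s N. w s * Y (add_mset (a + s) (add_mset b N))) M) / 4 +
    (if a = 0 then Y (add_mset b M) / 16 else 0)"
    by (simp add: virasoro_def w)
  have arith: "((p + 2 * i + u) / 4 + (if B then s / 16 else 0) + y +
        (1 / 4 * u' + 1 / 4 * v + 1 / 4 * x + (if B then 1 / 16 else 0) * t)) / 4 + z =
      (p + u + u' + x + 2 * i + v) / 16 + y / 4 + (if B then (s + t) / 64 else 0) + z"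
    for p i u u' v x s t y z :: complex and B
    by (cases B) (simp_all add: field_simps)
  show ?thesis
    unfolding V S1 S2 by (rule arith)
qed

text \<open>
  The operators \<open>\<partial>\<^sub>k - virasoro\<^sub>k\<close> span a Virasoro subalgebra, so the commutator of two of them is a
  multiple of a third one. As all three annihilate \<open>Y\<close> in lower weight, \<open>Y\<close> cannot depend on which
  of two arguments is removed first.
\<close>

lemma virasoro_commute:
  assumes rec: "\<And>k N. weight (add_mset k N) < weight (add_mset a (add_mset b M)) \<Longrightarrow>
    Y (add_mset k N) = virasoro Y k N"
  shows "virasoro Y a (add_mset b M) = virasoro Y b (add_mset a M)"
proof -
  define w where "w = (\<lambda>c. 2 * (2 * of_nat c + 1) :: complex)"
  have rec1: "\<forall>k N. weight (add_mset k N) < weight (add_mset a (add_mset b M)) \<longrightarrow>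
      Y (add_mset k N) = virasoro Y k N"
    and rec2: "\<forall>k N. weight (add_mset k N) < weight (add_mset b (add_mset a M)) \<longrightarrow>
      Y (add_mset k N) = virasoro Y k N"
    using rec by (simp_all add: add_mset_commute)
  note twice = virasoro_twice[OF rec1 w_def] virasoro_twice[OF rec2 w_def]
  define P where "P = (\<lambda>a b. \<Sum>i<a. \<Sum>j<b.
    Y (add_mset i (add_mset (a - 1 - i) (add_mset j (add_mset (b - 1 - j) M)))))"
  define U where "U = (\<lambda>a b. \<Sum>i<a. mpick_sum (\<lambda>s N. w s * Y (add_mset (b + s) (add_mset i (add_mset (a - 1 - i) N)))) M)"
  define W where "W = (\<lambda>a b. mpick_sum (\<lambda>s. mpick_sum (\<lambda>t N. w s * w t * Y (add_mset (a + s) (add_mset (b + t) N)))) M)"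
  define I where "I = (\<lambda>a b. \<Sum>i<a. w i * Y (add_mset (b + i) (add_mset (a - 1 - i) M)))"
  define A where "A = (\<lambda>a b. mpick_sum (\<lambda>s N. w s * w (a + s) * Y (add_mset (a + b + s) N)) M)"
  define A' where "A' = mpick_sum (\<lambda>s N. w s * Y (add_mset (a + b + s) N)) M"
  define S where "S = (\<lambda>a. \<Sum>i<a. Y (add_mset i (add_mset (a - 1 - i) M)))"
  define T where "T = (\<lambda>a. mpick_sum (\<lambda>s N. w s * Y (add_mset (a + s) N)) M)"
  have P: "P a b = P b a"
    unfolding P_def by (subst sum.swap) (simp add: add_mset_commute)
  have W: "W a b = W b a"
    unfolding W_def by (subst mpick_sum_swap) (simp add: add_mset_commute mult.commute)
  \<comment> \<open>The coefficients differ by \<open>w (a + s) - w (b + s)\<close>, that is by 4 (a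
    - b).\<close>
  have A: "A a b - A b a = 4 * (of_nat a - of_nat b) * A'"
  proof -
    have "A a b = mpick_sum (\<lambda>s N. 4 * (of_nat a - of_nat b) * (w s * Y (add_mset (a + b + s) N)) +
        w s * w (b + s) * Y (add_mset (b + a + s) N)) M"
      unfolding A_def by (intro mpick_sum_cong) (simp add: w_def algebra_simps)
    also have "\<dots> = 4 * (of_nat a - of_nat b) * A' + A b a"
      unfolding A_def A'_def mpick_sum_add mpick_sum_cmult ..
    finally show ?thesis by simp
  qed
  have I: "I a b - I b a = 2 * (of_nat a - of_nat b) * S (a + b)"
  proof -
    define f where "f = (\<lambda>p. Y (add_mset p (add_mset (a + b - 1 - p) M)))"
    have I': "I a b = 2 * (\<Sum>i<a. (2 * of_nat i + 1) * f (b + i))"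
      unfolding I_def f_def sum_distrib_left
      by (intro sum.cong) (auto simp: w_def mult_ac Suc_diff_Suc)
    have I'': "I b a = 2 * (\<Sum>i<b. (2 * of_nat i + 1) * f (a + i))"
      unfolding I_def f_def sum_distrib_left
      by (intro sum.cong) (auto simp: w_def mult_ac)
    have "f (a + b - 1 - p) = f p" if "p < a + b" for p
      using that by (simp add: f_def add_mset_commute)
    from virasoro_boundary[of a b f, OF this] show ?thesis
      unfolding I' I'' S_def f_def right_diff_distrib[symmetric] by simp
  qed
  \<comment> \<open>If \<open>a\<close> and \<open>b\<close> differ, then \<open>a + b\<close> is
    positive and the third operator has no constant term; if they agree, the left side is
    zero.\<close>
  have Z: "w b * Y (add_mset (a + b) M) - w a * Y (add_mset (a + b) M) =
     - (of_nat a - of_nat b) * (S (a + b) + A')"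
  proof (cases "a = b")
    case False
    have "Y (add_mset (a + b) M) = virasoro Y (a + b) M"
      by (rule rec) simp
    also have "\<dots> = (S (a + b) + A') / 4"
      using False by (auto simp: virasoro_def S_def A'_def w_def)
    finally show ?thesis by (simp add: w_def field_simps)
  qed simp
  have b0: "Y (add_mset b M) = (S b + T b) / 4 + (if b = 0 then Y M / 16 else 0)"
    using rec[of b M] by (simp add: virasoro_def S_def T_def w_def)
  have a0: "Y (add_mset a M) = (S a + T a) / 4 + (if a = 0 then Y M / 16 else 0)"
    using rec[of a M] by (simp add: virasoro_def S_def T_def w_def)
  have ab: "virasoro Y a (add_mset b M) =
      (P a b + U a b + U b a + W a b + 2 * I a b + A a b) / 16 + w b * Y (add_mset (a + b) M) / 4 +
      (if b = 0 then (S a + T a) / 64 else 0) + (if a = 0 then Y (add_mset b M) / 16 else 0)"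
    unfolding twice(1) P_def U_def W_def I_def A_def S_def T_def by simp
  have ba: "virasoro Y b (add_mset a M) =
      (P b a + U b a + U a b + W b a + 2 * I b a + A b a) / 16 + w a * Y (add_mset (a + b) M) / 4 +
      (if a = 0 then (S b + T b) / 64 else 0) + (if b = 0 then Y (add_mset a M) / 16 else 0)"
    unfolding twice(2) P_def U_def W_def I_def A_def S_def T_def by (simp add: add.commute[of b a])
  have "virasoro Y a (add_mset b M) - virasoro Y b (add_mset a M) =
     (2 * (I a b - I b a) + (A a b - A b a)) / 16 +
     (w b * Y (add_mset (a + b) M) - w a * Y (add_mset (a + b) M)) / 4"
    unfolding ab ba P W a0 b0 by (simp add: field_simps)
  also have "\<dots> = 0"
    unfolding I A Z by (simp add: field_simps)
  finally show ?thesis by simp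
qed

text \<open>\<open>Y\<close> reads a multiset through its sorted list, and below the current weight
  the induction makes this choice harmless. Removing the head of either list is one application of
  \<open>virasoro\<close>; different heads are exchanged by \<open>virasoro_commute\<close>.\<close>

lemma disc_mset_cong: "mset xs = mset ys \<Longrightarrow> disc xs = disc ys"
proof (induction "weight (mset xs)" arbitrary: xs ys rule: less_induct)
  case less
  define Y where "Y = (\<lambda>M. disc (sorted_list_of_multiset M))"
  have Y: "disc zs = Y (mset zs)" if "weight (mset zs) < weight (mset xs)" for zs
    unfolding Y_def by (rule less.hyps[OF that]) simp
  have rec: "disc (k # ks) = virasoro Y k (mset ks)" if le: "weight (mset (k # ks)) \<le> weight (mset xs)" for k ks
  proof -
    have 1: "(\<Sum>i<k. disc (i # (k - 1 - i) # ks)) = (\<Sum>i<k. Y (add_mset i (add_mset (k - 1 - i) (mset ks))))"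
    proof (intro sum.cong refl)
      fix i assume "i \<in> {..<k}"
      thus "disc (i # (k - 1 - i) # ks) = Y (add_mset i (add_mset (k - 1 - i) (mset ks)))"
        using Y[of "i # (k - 1 - i) # ks"] le by simp
    qed
    have "pick_sum (\<lambda>a v. 2 * (2 * of_nat a + 1) * disc ((k + a) # v)) ks =
        pick_sum (\<lambda>a v. 2 * (2 * of_nat a + 1) * Y (add_mset (k + a) (mset v))) ks"
    proof (rule pick_sum_cong)
      fix a v assume "(a, v) \<in> set (picks ks)"
      from picks_mset[OF this] le have "disc ((k + a) # v) = Y (mset ((k + a) # v))"
        by (intro Y) simp
      thus "2 * (2 * of_nat a + 1) * disc ((k + a) # v) = 2 * (2 * of_nat a + 1) * Y (add_mset (k + a) (mset v))"
        by simp
    qed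
    also have "\<dots> = mpick_sum (\<lambda>a N. 2 * (2 * of_nat a + 1) * Y (add_mset (k + a) N)) (mset ks)"
      by (rule pick_sum_mset)
    finally have 2: "pick_sum (\<lambda>a v. 2 * (2 * of_nat a + 1) * disc ((k + a) # v)) ks = \<dots>" .
    have 3: "disc ks = Y (mset ks)"
      using le by (intro Y) simp
    show ?thesis
      unfolding disc_recursion[of k ks] virasoro_def 1 2 3 ..
  qed
  show ?case
  proof (cases xs)
    case Nil
    thus ?thesis using less.prems by simp
  next
    case (Cons a S)
    then obtain b T where ys: "ys = b # T"
      using less.prems by (cases ys) auto
    have eq: "add_mset a (mset S) = add_mset b (mset T)"
      using less.prems Cons ys by simp
    have xs': "disc xs = virasoro Y a (mset S)"
      unfolding Cons by (rule rec) (simp add: Cons)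
    have ys': "disc ys = virasoro Y b (mset T)"
      unfolding ys by (rule rec) (simp add: ys less.prems)
    show ?thesis
    proof (cases "a = b")
      case True
      thus ?thesis using eq xs' ys' by simp
    next
      case False
      with eq obtain M where M: "mset S = add_mset b M" "mset T = add_mset a M"
        by (auto simp: add_eq_conv_ex)
      have "virasoro Y a (add_mset b M) = virasoro Y b (add_mset a M)"
      proof (rule virasoro_commute)
        fix k N assume "weight (add_mset k N) < weight (add_mset a (add_mset b M))"
        hence w: "weight (mset (k # sorted_list_of_multiset N)) < weight (mset xs)"
          using M Cons by simp
        show "Y (add_mset k N) = virasoro Y k N"
          using Y[OF w] rec[of k "sorted_list_of_multiset N"] w by simp
      qed
      thus ?thesis using xs' ys' M by simp
    qed
  qed
qed

subsection \<open>The one-point coefficients\<close>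

text \<open>
  Symmetry of the three-point coefficients makes the average of \<open>3 b\<close> over \<open>disc [i, j, b]\<close> with
  \<open>i + j + b = M - 1\<close> equal to \<open>M - 1\<close>. Eliminating the three-point coefficients by the two-point recursion,
  and then the two-point ones by the one-point recursion, leaves a recursion for the one-point
  coefficients: this is the level three null vector equation of the current.
\<close>

lemma disc_one_point_recursion:
  "32 * (of_nat M + 2) * disc [Suc M] = (2 * of_nat M + 1) * (2 * of_nat M + 3)\<^sup>2 * disc [M]"
proof -
  define f where "f = (\<lambda>b. disc [M - b, b])"
  define T where "T = (\<lambda>i b. disc [i, M - 1 - b - i, b])"
  have one: "(\<Sum>b\<le>M. f b) = 4 * disc [Suc M]"
  proof -
    have "(\<Sum>b\<le>M. f b) = (\<Sum>i<Suc M. disc [i, M - i])"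
      unfolding f_def lessThan_Suc_atMost by (intro sum.cong disc_mset_cong) auto
    thus ?thesis using disc_recursion[of "Suc M" "[]"] by (simp add: field_simps)
  qed
  have f_sym: "f (M - b) = f b" if "b \<le> M" for b
    unfolding f_def using that by (intro disc_mset_cong) auto
  have half: "2 * (\<Sum>b\<le>M. of_nat b * f b) = of_nat M * (\<Sum>b\<le>M. f b)"
  proof -
    have "(\<Sum>b\<le>M. of_nat b * f b) = (\<Sum>b\<le>M. of_nat (M - b) * f b)"
      using f_sym by (intro sum.reindex_bij_witness[of _ "\<lambda>b. M - b" "\<lambda>b. M - b"]) auto
    hence "2 * (\<Sum>b\<le>M. of_nat b * f b) = (\<Sum>b\<le>M. of_nat b * f b) + (\<Sum>b\<le>M. of_nat (M - b) * f b)"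
      by simp
    also have "\<dots> = (\<Sum>b\<le>M. of_nat M * f b)"
      unfolding sum.distrib[symmetric] by (intro sum.cong) (auto simp: of_nat_diff algebra_simps)
    finally show ?thesis by (simp add: sum_distrib_left)
  qed
  \<comment> \<open>Only here, where the head is 0, does the constant 1/16 enter.\<close>
  have last: "f M = disc [M] * ((2 * of_nat M + 1) / 2 + 1 / 16)"
    unfolding f_def using disc_recursion[of 0 "[M]"] by (simp add: field_simps)
  have two: "(\<Sum>i<M - b. T i b) = 4 * f b - 2 * (2 * of_nat b + 1) * disc [M]" if "b < M" for b
  proof -
    have "M - b - 1 - i = M - 1 - b - i" for i by simp
    hence "f b * 4 = (\<Sum>i<M - b. T i b) + 2 * (2 * of_nat b + 1) * disc [M]"
      using disc_recursion[of "M - b" "[b]"] that by (simp add: f_def T_def del: One_nat_def)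
    thus ?thesis by (simp add: algebra_simps)
  qed
  have three: "(\<Sum>b<M. \<Sum>i<M - b. (3 * of_nat b - of_nat M + 1) * T i b) = 0"
  proof -
    let ?I = "SIGMA b:{..<M}. {..<M - b}"
    \<comment> \<open>\<open>sw1\<close> exchanges the last argument with the first,
      \<open>sw2\<close> exchanges it with the middle one.\<close>
    have sw1: "(\<Sum>(b, i)\<in>?I. of_nat b * T i b) = (\<Sum>(b, i)\<in>?I. of_nat i * T i b)"
    proof (rule sum.reindex_bij_witness[of _ prod.swap prod.swap])
      fix p assume "p \<in> ?I"
      then obtain b i where p: "p = (b, i)" "b < M" "i < M - b" by auto
      have "T i b = T b i"
        unfolding T_def using p by (intro disc_mset_cong) (auto simp: algebra_simps)
      thus "(case prod.swap p of (b, i) \<Rightarrow> of_nat i * T i b) = (case p of (b, i) \<Rightarrow> of_nat b * T i b)"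
        using p by simp
    qed auto
    have sw2: "(\<Sum>(b, i)\<in>?I. of_nat b * T i b) = (\<Sum>(b, i)\<in>?I. of_nat (M - 1 - b - i) * T i b)"
    proof (rule sum.reindex_bij_witness[of _ "\<lambda>(b, i). (M - 1 - b - i, i)" "\<lambda>(b, i). (M - 1 - b - i, i)"])
      fix p assume "p \<in> ?I"
      then obtain b i where p: "p = (b, i)" "b < M" "i < M - b" by auto
      have "T i (M - 1 - b - i) = T i b"
        unfolding T_def using p by (intro disc_mset_cong) auto
      thus "(case (case p of (b, i) \<Rightarrow> (M - 1 - b - i, i)) of (b, i) \<Rightarrow> of_nat (M - 1 - b - i) * T i b) =
            (case p of (b, i) \<Rightarrow> of_nat b * T i b)"
        using p by simp
    qed auto
    have "(\<Sum>(b, i)\<in>?I. (3 * of_nat b - of_nat M + 1) * T i b) =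
        (\<Sum>(b, i)\<in>?I. 2 * (of_nat b * T i b) - of_nat i * T i b - of_nat (M - 1 - b - i) * T i b)"
      by (intro sum.cong) (auto simp: of_nat_diff algebra_simps)
    also have "\<dots> = 2 * (\<Sum>(b, i)\<in>?I. of_nat b * T i b) - (\<Sum>(b, i)\<in>?I. of_nat i * T i b) -
        (\<Sum>(b, i)\<in>?I. of_nat (M - 1 - b - i) * T i b)"
      by (simp only: case_prod_unfold sum_subtractf sum_distrib_left)
    also have "\<dots> = 0"
      unfolding sw1[symmetric] sw2[symmetric] by simp
    finally show ?thesis by (subst sum.Sigma) auto
  qed
  have "(\<Sum>b<M. (3 * of_nat b - of_nat M + 1) * (4 * f b - 2 * (2 * of_nat b + 1) * disc [M])) = 0"
    using three by (simp add: sum_distrib_left[symmetric] two)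
  also have "(\<Sum>b<M. (3 * of_nat b - of_nat M + 1) * (4 * f b - 2 * (2 * of_nat b + 1) * disc [M])) =
      (\<Sum>b<M. 4 * ((3 * of_nat b - of_nat M + 1) * f b) -
        2 * disc [M] * ((3 * of_nat b - of_nat M + 1) * (2 * of_nat b + 1)))"
    by (intro sum.cong) (auto simp: algebra_simps)
  finally have eq: "4 * (\<Sum>b<M. (3 * of_nat b - of_nat M + 1) * f b) =
      2 * disc [M] * (\<Sum>b<M. (3 * of_nat b - of_nat M + 1) * (2 * of_nat b + 1))"
    by (simp only: sum_subtractf sum_distrib_left[symmetric] right_minus_eq)
  \<comment> \<open>\<open>m\<close> is kept apart from \<open>n\<close>, since the induction would
    not close with both equal to \<open>M\<close>.\<close>
  have poly: "2 * (\<Sum>b<n. (3 * of_nat b - m + 1) * (2 * of_nat b + 1)) =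
      4 * of_nat n ^ 3 - (2 * m + 1) * of_nat n ^ 2 - of_nat n" for n and m :: complex
    by (induction n) (simp_all add: algebra_simps power2_eq_square power3_eq_cube)
  have "(\<Sum>b\<le>M. (3 * of_nat b - of_nat M + 1) * f b) =
      3 * (\<Sum>b\<le>M. of_nat b * f b) + (1 - of_nat M) * (\<Sum>b\<le>M. f b)"
    unfolding sum_distrib_left sum.distrib[symmetric] by (intro sum.cong) (auto simp: algebra_simps)
  also have "\<dots> = 2 * (of_nat M + 2) * disc [Suc M]"
    using half unfolding one by (simp add: field_simps)
  finally have "(\<Sum>b<M. (3 * of_nat b - of_nat M + 1) * f b) =
      2 * (of_nat M + 2) * disc [Suc M] - (2 * of_nat M + 1) * f M"
    by (simp add: lessThan_Suc_atMost[symmetric] algebra_simps)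
  \<comment> \<open>Elimination gives 8 (m + 2) D = (2 m + 1) (m^2 - m + (16 m + 9) / 4) d, and the
    last factor of the coefficient is (m + 3/2)^2.\<close>
  moreover have "32 * (m + 2) * D = (2 * m + 1) * (2 * m + 3)\<^sup>2 * d"
    if "4 * A = 2 * d * B" "2 * B = 4 * m ^ 3 - (2 * m + 1) * m\<^sup>2 - m"
      "f = d * ((2 * m + 1) / 2 + 1 / 16)" "A = 2 * (m + 2) * D - (2 * m + 1) * f"
    for A B D d f m :: complex
  proof -
    have "16 * f = d * (16 * m + 9)"
      unfolding that(3) by (simp add: field_simps)
    thus ?thesis using that(1,2,4) by algebra
  qed
  ultimately show ?thesis using eq poly[of "of_nat M" M] last by blast
qed

text \<open>The argument \<open>k\<close> belongs to genus k + 1. The ratio of consecutive values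
  matches because 2 (k + 2) (2 k + 3) appears cubed over 256 (k + 2)^4.\<close>

lemma disc_one_point:
  "disc [k] = 2 powi (1 - 8 * int (Suc k)) *
     (fact (2 * Suc k) ^ 3 / (fact (Suc k) ^ 4 * (2 * of_nat (Suc k) - 1)))"
proof (induction k)
  case 0
  have "disc [0] = 1 / 16" using disc_recursion[of 0 "[]"] by simp
  thus ?case by (simp add: fact_numeral power_int_minus field_simps)
next
  case (Suc k)
  define n :: complex where "n = of_nat k"
  define F :: complex where "F = fact (2 * Suc k)"
  define G :: complex where "G = fact (Suc k)"
  define P :: complex where "P = 2 powi (1 - 8 * int (Suc k))"
  have nz: "2 * n + 1 \<noteq> 0" "2 * n + 3 \<noteq> 0" "n + 2 \<noteq> 0" "G \<noteq> 0"
  proof -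
    have "2 * n + 1 = of_nat (2 * k + 1)" "2 * n + 3 = of_nat (2 * k + 3)" "n + 2 = of_nat (k + 2)"
      by (simp_all add: n_def)
    thus "2 * n + 1 \<noteq> 0" "2 * n + 3 \<noteq> 0" "n + 2 \<noteq> 0" by (simp_all only: of_nat_eq_0_iff)
    show "G \<noteq> 0" unfolding G_def by (rule fact_nonzero)
  qed
  have F: "fact (2 * Suc (Suc k)) = (2 * n + 4) * (2 * n + 3) * F"
    by (simp add: F_def n_def algebra_simps)
  have G: "fact (Suc (Suc k)) = (n + 2) * G"
    by (simp add: G_def n_def algebra_simps)
  have P: "2 powi (1 - 8 * int (Suc (Suc k))) = P / 256"
  proof -
    have "2 powi (m - 8) = (2 powi m / 256 :: complex)" for m
      by (simp add: power_int_diff)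
    moreover have "1 - 8 * int (Suc (Suc k)) = (1 - 8 * int (Suc k)) - 8" by simp
    ultimately show ?thesis unfolding P_def by metis
  qed
  have IH: "disc [k] = P * (F ^ 3 / (G ^ 4 * (2 * n + 1)))"
    using Suc.IH by (simp add: F_def G_def P_def n_def)
  have "disc [Suc k] = (2 * n + 1) * (2 * n + 3)\<^sup>2 * disc [k] / (32 * (n + 2))"
  proof (subst nonzero_eq_divide_eq)
    show "disc [Suc k] * (32 * (n + 2)) = (2 * n + 1) * (2 * n + 3)\<^sup>2 * disc [k]"
      using disc_one_point_recursion[of k] by (simp only: n_def mult_ac)
    show "32 * (n + 2) \<noteq> 0"
      using nz(3) by (metis mult_eq_0_iff zero_neq_numeral)
  qed
  also have "\<dots> = P / 256 * (((2 * n + 4) * (2 * n + 3) * F) ^ 3 / (((n + 2) * G) ^ 4 * (2 * n + 3)))"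
  proof -
    have "a * b\<^sup>2 * (P * (F ^ 3 / (G ^ 4 * a))) / (32 * u) = P / 256 * ((2 * u * b * F) ^ 3 / ((u * G) ^ 4 * b))"
      if "a \<noteq> 0" "b \<noteq> 0" "u \<noteq> 0" for a b u :: complex
      using that nz(4) by (simp add: divide_simps power2_eq_square power3_eq_cube power4_eq_xxxx)
    moreover have "2 * n + 4 = 2 * (n + 2)" by simp
    ultimately show ?thesis unfolding IH using nz(1-3) by metis
  qed
  finally show ?case
    unfolding F G P by (simp add: n_def add.commute algebra_simps)
qed

subsection \<open>Residues\<close>

text \<open>Carrying the Laurent expansion along makes residues additive without side conditions on
  domains, so nested sums are handled by introduction rules.\<close>

definition has_residue :: "(complex \<Rightarrow> complex) \<Rightarrow> complex \<Rightarrow> bool" where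
  "has_residue f r \<longleftrightarrow> (\<exists>F. f has_laurent_expansion F \<and> fls_residue F = r)"

lemma has_residue_imp_residue: "has_residue f r \<Longrightarrow> residue f 0 = r"
  by (auto simp: has_residue_def dest: has_laurent_expansion_residue_0)

lemma has_residue_cong:
  assumes "has_residue g r" "\<forall>\<^sub>F z in at 0. f z = g z"
  shows "has_residue f r"
  using assms has_laurent_expansion_cong[of f g] by (auto simp: has_residue_def)

lemma has_residue_add: "has_residue f r \<Longrightarrow> has_residue g s \<Longrightarrow> has_residue (\<lambda>z. f z + g z) (r + s)"
  unfolding has_residue_def using has_laurent_expansion_add by fastforce

lemma has_residue_cmult: "has_residue f r \<Longrightarrow> has_residue (\<lambda>z. c * f z) (c * r)"
  unfolding has_residue_def using has_laurent_expansion_cmult_left by fastforce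

lemma has_residue_analytic:
  assumes "f analytic_on {0}"
  shows "has_residue f 0"
proof -
  have "f has_laurent_expansion fps_to_fls (fps_expansion f 0)"
    using assms by (intro has_laurent_expansion_fps analytic_at_imp_has_fps_expansion_0)
  thus ?thesis by (force simp: has_residue_def)
qed

lemma has_residue_0: "has_residue (\<lambda>z. 0) 0"
  by (intro has_residue_analytic) auto

lemma has_residue_sum:
  "(\<And>x. x \<in> A \<Longrightarrow> has_residue (\<lambda>z. f z x) (r x)) \<Longrightarrow>
     has_residue (\<lambda>z. \<Sum>x\<in>A. f z x) (\<Sum>x\<in>A. r x)"
  by (induction A rule: infinite_finite_induct) (auto intro: has_residue_add has_residue_0)

lemma has_residue_sum_list:
  "(\<And>x. x \<in> set xs \<Longrightarrow> has_residue (\<lambda>z. f z x) (r x)) \<Longrightarrow>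
     has_residue (\<lambda>z. \<Sum>x\<leftarrow>xs. f z x) (\<Sum>x\<leftarrow>xs. r x)"
  by (induction xs) (auto intro: has_residue_add has_residue_0)

lemma has_residue_split_sum:
  assumes "\<And>u v. (u, v) \<in> set (splits xs) \<Longrightarrow> has_residue (\<lambda>z. h z u v) (r u v)"
  shows "has_residue (\<lambda>z. split_sum (h z) xs) (split_sum r xs)"
  unfolding split_sum_def by (intro has_residue_sum_list) (use assms in auto)

lemma has_residue_pick_sum:
  assumes "\<And>a v. (a, v) \<in> set (picks xs) \<Longrightarrow> has_residue (\<lambda>z. h z a v) (r a v)"
  shows "has_residue (\<lambda>z. pick_sum (h z) xs) (pick_sum r xs)"
  unfolding pick_sum_def by (intro has_residue_sum_list) (use assms in auto)

text \<open>After the substitution only even exponents occur, and division by the odd power moves 2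
  p to -1.\<close>

lemma has_residue_square:
  assumes "h has_fps_expansion H"
  shows "has_residue (\<lambda>z. h (z\<^sup>2) / z ^ (2 * p + 1)) (fps_nth H p)"
proof -
  have "(h \<circ> (\<lambda>z. z\<^sup>2)) has_fps_expansion (H oo fps_X ^ 2)"
    by (intro has_fps_expansion_compose assms fps_expansion_intros) (simp add: fps_nth_power_0)
  from has_laurent_expansion_shift'[OF has_laurent_expansion_fps[OF this], of "int (2 * p + 1)"]
  have "(\<lambda>z. h (z\<^sup>2) / z ^ (2 * p + 1)) has_laurent_expansion
      fls_shift (int (2 * p + 1)) (fps_to_fls (H oo fps_X ^ 2))"
    by (simp add: power_int_minus divide_inverse o_def del: of_nat_add of_nat_Suc of_nat_mult power_Suc)
  thus ?thesis
    unfolding has_residue_def by (intro exI conjI) (auto simp: fps_nth_compose_X_power nat_mult_distrib)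
qed

lemma has_fps_expansion_geometric:
  fixes c :: complex
  assumes "c \<noteq> 0"
  shows "(\<lambda>t. 1 / (c - t)) has_fps_expansion Abs_fps (\<lambda>n. (1 / c) ^ Suc n)"
proof (rule has_fps_expansionI)
  have "\<forall>\<^sub>F t in nhds 0. t \<in> ball 0 (norm c)"
    using assms by (intro eventually_nhds_in_open) auto
  thus "\<forall>\<^sub>F t in nhds 0. (\<lambda>n. fps_nth (Abs_fps (\<lambda>n. (1 / c) ^ Suc n)) n * t ^ n) sums (1 / (c - t))"
  proof eventually_elim
    case (elim t)
    hence elim: "norm t < norm c" by simp
    hence "(\<lambda>n. (1 / c) * (t / c) ^ n) sums ((1 / c) * (1 / (1 - t / c)))"
      by (intro sums_mult geometric_sums) (use assms in \<open>simp add: norm_divide\<close>)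
    moreover have "c \<noteq> t" using elim by auto
    ultimately show ?case
      using assms by (simp add: power_divide field_simps)
  qed
qed

text \<open>With c = w^2 and t = z^2 the function is 1 / (z - w)^2 + 1 / (z + w)^2. Its series is
  that of (2 / c) (2 / (1 - q)^2 - 1 / (1 - q)) at q = t / c.\<close>

lemma has_fps_expansion_geometric_deriv:
  fixes c :: complex
  assumes "c \<noteq> 0"
  shows "(\<lambda>t. 2 * (c + t) / (c - t)\<^sup>2) has_fps_expansion
    Abs_fps (\<lambda>n. 2 * (2 * of_nat n + 1) * (1 / c) ^ Suc n)"
proof (rule has_fps_expansionI)
  have "\<forall>\<^sub>F t in nhds 0. t \<in> ball 0 (norm c)"
    using assms by (intro eventually_nhds_in_open) auto
  thus "\<forall>\<^sub>F t in nhds 0. (\<lambda>n. fps_nth (Abs_fps (\<lambda>n. 2 * (2 * of_nat n + 1) * (1 / c) ^ Suc n)) n * t ^ n)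
      sums (2 * (c + t) / (c - t)\<^sup>2)"
  proof eventually_elim
    case (elim t)
    hence elim: "norm t < norm c" by simp
    hence lt: "norm (t / c) < 1" using assms by (simp add: norm_divide)
    have ne: "c \<noteq> t" using elim by auto
    have "(\<lambda>n. (2 / c) * (2 * (of_nat (Suc n) * (t / c) ^ n) - (t / c) ^ n)) sums
        ((2 / c) * (2 * (1 / (1 - t / c)\<^sup>2) - 1 / (1 - t / c)))"
      by (intro sums_mult sums_diff geometric_sums geometric_deriv_sums lt)
    moreover have "(2 / c) * (2 * (1 / (1 - t / c)\<^sup>2) - 1 / (1 - t / c)) = 2 * (c + t) / (c - t)\<^sup>2"
    proof -
      have "1 - t / c = (c - t) / c" using assms by (simp add: field_simps)
      thus ?thesis using assms ne by (simp add: power2_eq_square divide_simps) (simp add: algebra_simps)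
    qed
    moreover have "(2 / c) * (2 * (of_nat (Suc n) * (t / c) ^ n) - (t / c) ^ n) =
        2 * (2 * of_nat n + 1) * (1 / c) ^ Suc n * t ^ n" for n
      using assms by (simp add: power_divide field_simps)
    ultimately show ?case by (simp only: fps_nth_Abs_fps)
  qed
qed

section \<open>Residues of the kernel against even powers and against omega^0_2\<close>

lemma kernel_times_power:
  fixes z :: complex
  assumes "z \<noteq> 0"
  shows "z / (4 * c) * (x * (1 / z\<^sup>2) ^ Suc p) = 1 / 4 * (x * (1 / c) / z ^ (2 * p + 1))"
proof -
  have "(1 / z\<^sup>2) ^ Suc p = 1 / z ^ (2 * Suc p)"
    by (simp only: power_one_over power_mult)
  hence "z * (1 / z\<^sup>2) ^ Suc p = 1 / z ^ (2 * p + 1)"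
    using assms by (simp add: field_simps)
  moreover have "z / (4 * c) * (x * q) = 1 / 4 * (x * (1 / c) * (z * q))" for q
    by simp
  ultimately show ?thesis by (metis times_divide_eq_right mult.right_neutral)
qed

lemma has_residue_kernel_power:
  assumes "z1 \<noteq> 0"
  shows "has_residue (\<lambda>z. z / (4 * (z1\<^sup>2 - z\<^sup>2)) * (1 / z\<^sup>2) ^ Suc p) (1 / 4 * (1 / z1\<^sup>2) ^ Suc p)"
proof -
  have "has_residue (\<lambda>z. 1 / 4 * (1 / (z1\<^sup>2 - z\<^sup>2) / z ^ (2 * p + 1))) (1 / 4 * (1 / z1\<^sup>2) ^ Suc p)"
    using has_residue_square[OF has_fps_expansion_geometric[of "z1\<^sup>2"], of p] assms
    by (intro has_residue_cmult) simp
  moreover have "\<forall>\<^sub>F z in at 0. z / (4 * (z1\<^sup>2 - z\<^sup>2)) * (1 / z\<^sup>2) ^ Suc p =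
      1 / 4 * (1 / (z1\<^sup>2 - z\<^sup>2) / z ^ (2 * p + 1))"
    using eventually_neq_at_within[of 0]
  proof eventually_elim
    case (elim z)
    show ?case using kernel_times_power[OF elim, of "z1\<^sup>2 - z\<^sup>2" 1 p] by simp
  qed
  ultimately show ?thesis by (rule has_residue_cong)
qed

text \<open>The residue is a coefficient of the Cauchy product of two geometric-type series in z^2;
  \<open>m\<close> is the part of the exponent that passes to the variable \<open>w\<close>.\<close>

lemma has_residue_kernel_omega02:
  assumes "z1 \<noteq> 0" "w \<noteq> 0"
  shows "has_residue (\<lambda>z. z / (4 * (z1\<^sup>2 - z\<^sup>2)) * ((1 / (z - w)\<^sup>2 + 1 / (- z - w)\<^sup>2) * (1 / z\<^sup>2) ^ Suc p))
    ((\<Sum>m\<le>p. (1 / z1\<^sup>2) ^ Suc (p - m) * (2 * (2 * of_nat m + 1) * (1 / w\<^sup>2) ^ Suc m)) / 4)"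
proof -
  let ?E = "Abs_fps (\<lambda>n. (1 / z1\<^sup>2) ^ Suc n)"
  let ?D = "Abs_fps (\<lambda>n. 2 * (2 * of_nat n + 1) * (1 / w\<^sup>2) ^ Suc n)"
  have "(\<lambda>t. 2 * (w\<^sup>2 + t) / (w\<^sup>2 - t)\<^sup>2 * (1 / (z1\<^sup>2 - t))) has_fps_expansion ?D * ?E"
    using assms by (intro has_fps_expansion_mult has_fps_expansion_geometric has_fps_expansion_geometric_deriv) auto
  from has_residue_square[OF this, of p]
  have "has_residue (\<lambda>z. 2 * (w\<^sup>2 + z\<^sup>2) / (w\<^sup>2 - z\<^sup>2)\<^sup>2 * (1 / (z1\<^sup>2 - z\<^sup>2)) / z ^ (2 * p + 1)) (fps_nth (?D * ?E) p)" .
  moreover have "fps_nth (?D * ?E) p =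
      (\<Sum>m\<le>p. (1 / z1\<^sup>2) ^ Suc (p - m) * (2 * (2 * of_nat m + 1) * (1 / w\<^sup>2) ^ Suc m))"
    unfolding fps_mult_nth fps_nth_Abs_fps atLeast0AtMost by (intro sum.cong refl) (rule mult.commute)
  ultimately have "has_residue (\<lambda>z. 2 * (w\<^sup>2 + z\<^sup>2) / (w\<^sup>2 - z\<^sup>2)\<^sup>2 * (1 / (z1\<^sup>2 - z\<^sup>2)) / z ^ (2 * p + 1))
      (\<Sum>m\<le>p. (1 / z1\<^sup>2) ^ Suc (p - m) * (2 * (2 * of_nat m + 1) * (1 / w\<^sup>2) ^ Suc m))"
    by simp
  from has_residue_cmult[OF this, of "1 / 4"]
  have "has_residue (\<lambda>z. 1 / 4 * (2 * (w\<^sup>2 + z\<^sup>2) / (w\<^sup>2 - z\<^sup>2)\<^sup>2 * (1 / (z1\<^sup>2 - z\<^sup>2)) / z ^ (2 * p + 1)))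
      ((\<Sum>m\<le>p. (1 / z1\<^sup>2) ^ Suc (p - m) * (2 * (2 * of_nat m + 1) * (1 / w\<^sup>2) ^ Suc m)) / 4)"
    by simp
  moreover have "\<forall>\<^sub>F z in at 0. z / (4 * (z1\<^sup>2 - z\<^sup>2)) * ((1 / (z - w)\<^sup>2 + 1 / (- z - w)\<^sup>2) * (1 / z\<^sup>2) ^ Suc p) =
      1 / 4 * (2 * (w\<^sup>2 + z\<^sup>2) / (w\<^sup>2 - z\<^sup>2)\<^sup>2 * (1 / (z1\<^sup>2 - z\<^sup>2)) / z ^ (2 * p + 1))"
  proof -
    have "\<forall>\<^sub>F z in at (0::complex). z \<noteq> 0" "\<forall>\<^sub>F z in at (0::complex). z \<noteq> w" "\<forall>\<^sub>F z in at (0::complex). z \<noteq> - w"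
      by (rule eventually_neq_at_within)+
    thus ?thesis
    proof eventually_elim
      case (elim z)
      have ne: "z - w \<noteq> 0" "z + w \<noteq> 0" using elim by (auto simp: add_eq_0_iff2)
      have f: "w\<^sup>2 - z\<^sup>2 = - ((z - w) * (z + w))" by (simp add: power2_eq_square algebra_simps)
      have "(- z - w)\<^sup>2 = (z + w)\<^sup>2" by (simp add: power2_eq_square algebra_simps)
      hence "1 / (z - w)\<^sup>2 + 1 / (- z - w)\<^sup>2 = 2 * (w\<^sup>2 + z\<^sup>2) / (w\<^sup>2 - z\<^sup>2)\<^sup>2"
        unfolding f using ne by (simp add: divide_simps) (simp add: power2_eq_square algebra_simps)
      thus ?case
        using kernel_times_power[OF elim(1)] by metis
    qed
  qed
  ultimately show ?thesis by (rule has_residue_cong)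
qed

subsection \<open>Laurent coefficients of the invariants\<close>

text \<open>The exponent \<open>Suc m\<close> matches dw / w^(2 m + 2). One cut-off \<open>N\<close>
  for all variables keeps the sums finite, and it loses nothing for \<open>corr g\<close> with g
  \<le> N.\<close>

fun expand :: "nat \<Rightarrow> (nat list \<Rightarrow> complex) \<Rightarrow> complex list \<Rightarrow> complex" where
  "expand N f [] = f []"
| "expand N f (w # ws) = (\<Sum>m\<le>N. (1 / w\<^sup>2) ^ Suc m * expand N (\<lambda>ks. f (m # ks)) ws)"

lemma expand_zero [simp]: "expand N (\<lambda>ks. 0) ws = 0"
  by (induction ws) auto

lemma expand_add: "expand N (\<lambda>ks. f ks + h ks) ws = expand N f ws + expand N h ws"
  by (induction ws arbitrary: f h) (auto simp: sum.distrib algebra_simps)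

lemma expand_cmult: "expand N (\<lambda>ks. c * f ks) ws = c * expand N f ws"
  by (induction ws arbitrary: f) (auto simp: sum_distrib_left mult_ac)

lemma expand_sum: "expand N (\<lambda>ks. \<Sum>i\<in>I. f i ks) ws = (\<Sum>i\<in>I. expand N (f i) ws)"
  by (induction I rule: infinite_finite_induct) (auto simp: expand_add)

lemma expand_Nil_indicator: "expand N (\<lambda>ks. if P \<and> ks = [] then c else 0) ws = (if P \<and> ws = [] then c else 0)"
  by (cases ws) auto

text \<open>\<open>expand\<close> and \<open>splits\<close> consume one entry at a time, so each
  index follows its variable into the same part.\<close>

lemma expand_split_sum:
  "expand N (split_sum (\<lambda>u v. f u * h v)) ws = split_sum (\<lambda>u v. expand N f u * expand N h v) ws"
proof (induction ws arbitrary: f h)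
  case (Cons w ws)
  have "expand N (split_sum (\<lambda>u v. f u * h v)) (w # ws) =
     (\<Sum>m\<le>N. (1 / w\<^sup>2) ^ Suc m * split_sum (\<lambda>u v. expand N (\<lambda>ks. f (m # ks)) u * expand N h v) ws) +
     (\<Sum>m\<le>N. (1 / w\<^sup>2) ^ Suc m * split_sum (\<lambda>u v. expand N f u * expand N (\<lambda>ks. h (m # ks)) v) ws)"
    by (simp only: expand.simps split_sum_simps expand_add Cons.IH distrib_left sum.distrib)
  also have "\<dots> = split_sum (\<lambda>u v. expand N f u * expand N h v) (w # ws)"
    unfolding split_sum_simps expand.simps sum_distrib_left sum_distrib_right split_sum_sum
      split_sum_cmult[symmetric]
    by (simp only: mult_ac)
  finally show ?case .
qed simp

lemma expand_pick_sum:
  "expand N (pick_sum h) ws = pick_sum (\<lambda>w v. \<Sum>m\<le>N. (1 / w\<^sup>2) ^ Suc m * expand N (h m) v) ws"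
proof (induction ws arbitrary: h)
  case (Cons w ws)
  have "pick_sum (\<lambda>a v. \<Sum>m\<le>N. (1 / a\<^sup>2) ^ Suc m * expand N (h m) (w # v)) ws =
     pick_sum (\<lambda>a v. \<Sum>k\<le>N. (1 / w\<^sup>2) ^ Suc k * (\<Sum>m\<le>N. (1 / a\<^sup>2) ^ Suc m * expand N (\<lambda>ks. h m (k # ks)) v)) ws"
    unfolding expand.simps sum_distrib_left
    by (subst sum.swap) (simp only: mult_ac)
  also have "\<dots> = (\<Sum>k\<le>N. (1 / w\<^sup>2) ^ Suc k * expand N (pick_sum (\<lambda>a v. h a (k # v))) ws)"
    unfolding pick_sum_sum pick_sum_cmult Cons.IH ..
  finally have "pick_sum (\<lambda>a v. \<Sum>m\<le>N. (1 / a\<^sup>2) ^ Suc m * expand N (h m) (w # v)) ws =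
    (\<Sum>k\<le>N. (1 / w\<^sup>2) ^ Suc k * expand N (pick_sum (\<lambda>a v. h a (k # v))) ws)" .
  moreover have "expand N (pick_sum h) (w # ws) = (\<Sum>m\<le>N. (1 / w\<^sup>2) ^ Suc m * expand N (h m) ws) +
     (\<Sum>k\<le>N. (1 / w\<^sup>2) ^ Suc k * expand N (pick_sum (\<lambda>a v. h a (k # v))) ws)"
    by (simp add: expand_add distrib_left sum.distrib)
  ultimately show ?case by simp
qed simp

lemma expand_uminus: "expand N f (- w # ws) = expand N f (w # ws)"
  by simp

text \<open>Restores the genus. In genus 0 it is zero: omega^0_2 is not a polynomial in the inverse
  squares and is treated separately, and the invariants with more points vanish.\<close>

definition corr :: "nat \<Rightarrow> nat list \<Rightarrow> complex" where
  "corr g ks = (if Suc (sum_list ks) = g then conn ks else 0)"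

text \<open>The bracket of the recursion without the terms that contain omega^0_2. For
  \<open>g = 1\<close> the first summand is zero, as \<open>corr 0\<close> is.\<close>

definition corr_pair :: "nat \<Rightarrow> nat \<Rightarrow> nat \<Rightarrow> nat list \<Rightarrow> complex" where
  "corr_pair g i j ks = corr (g - 1) (i # j # ks) +
     (\<Sum>g1\<in>{1..<g}. split_sum (\<lambda>u v. corr g1 (i # u) * corr (g - g1) (j # v)) ks)"

text \<open>By homogeneity \<open>i\<close> and \<open>u\<close> determine the genus of their
  factor, so a single \<open>g1\<close> survives.\<close>

lemma corr_pair_eq:
  "corr_pair g i j ks = (if i + j + sum_list ks + 2 = g
     then conn (i # j # ks) + split_sum (\<lambda>u v. conn (i # u) * conn (j # v)) ks else 0)"
proof -
  have "(\<Sum>g1\<in>{1..<g}. split_sum (\<lambda>u v. corr g1 (i # u) * corr (g - g1) (j # v)) ks) =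
      split_sum (\<lambda>u v. \<Sum>g1\<in>{1..<g}. corr g1 (i # u) * corr (g - g1) (j # v)) ks"
    by (simp only: split_sum_sum)
  also have "\<dots> = split_sum (\<lambda>u v. (if i + j + sum_list ks + 2 = g then 1 else 0) * (conn (i # u) * conn (j # v))) ks"
  proof (rule split_sum_cong)
    fix u v assume uv: "(u, v) \<in> set (splits ks)"
    have s: "sum_list ks = sum_list u + sum_list v" by (rule splits_sum_list[OF uv])
    have "(\<Sum>g1\<in>{1..<g}. corr g1 (i # u) * corr (g - g1) (j # v)) =
      (\<Sum>g1\<in>{1..<g}. if Suc (i + sum_list u) = g1 then conn (i # u) * corr (g - g1) (j # v) else 0)"
      by (intro sum.cong) (auto simp: corr_def)
    also have "\<dots> = (if i + j + sum_list ks + 2 = g then 1 else 0) * (conn (i # u) * conn (j # v))"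
      by (subst sum.delta') (auto simp: corr_def s)
    finally show "(\<Sum>g1\<in>{1..<g}. corr g1 (i # u) * corr (g - g1) (j # v)) = \<dots>" .
  qed
  also have "\<dots> = (if i + j + sum_list ks + 2 = g then 1 else 0) * split_sum (\<lambda>u v. conn (i # u) * conn (j # v)) ks"
    by (rule split_sum_cmult)
  finally show ?thesis
    by (auto simp: corr_pair_def corr_def)
qed

lemma corr_Cons:
  "corr g (k # ks) = ((\<Sum>i<k. corr_pair g i (k - 1 - i) ks) +
      pick_sum (\<lambda>a v. 2 * (2 * of_nat a + 1) * corr g ((k + a) # v)) ks) / 4 +
     (if (g = 1 \<and> k = 0) \<and> ks = [] then 1 / 16 else 0)"
proof -
  let ?c = "if Suc (k + sum_list ks) = g then 1 else 0 :: complex"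
  have 1: "corr_pair g i (k - 1 - i) ks =
     ?c * (conn (i # (k - 1 - i) # ks) + split_sum (\<lambda>u v. conn (i # u) * conn ((k - 1 - i) # v)) ks)"
    if "i < k" for i
    using that by (auto simp: corr_pair_eq)
  have 2: "pick_sum (\<lambda>a v. 2 * (2 * of_nat a + 1) * corr g ((k + a) # v)) ks =
     ?c * pick_sum (\<lambda>a v. 2 * (2 * of_nat a + 1) * conn ((k + a) # v)) ks"
    unfolding pick_sum_cmult[symmetric]
    by (intro pick_sum_cong) (auto simp: corr_def picks_sum_list add.assoc)
  have 3: "(if (g = 1 \<and> k = 0) \<and> ks = [] then 1 / 16 else 0) = ?c * (if k = 0 \<and> ks = [] then 1 / 16 else 0)"
    by auto
  have 4: "(\<Sum>i<k. corr_pair g i (k - 1 - i) ks) = ?c *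
      (\<Sum>i<k. conn (i # (k - 1 - i) # ks) + split_sum (\<lambda>u v. conn (i # u) * conn ((k - 1 - i) # v)) ks)"
    unfolding sum_distrib_left by (intro sum.cong refl 1) simp
  have "corr g (k # ks) = ?c * conn (k # ks)"
    by (simp add: corr_def)
  thus ?thesis
    unfolding conn_Cons[of k ks] 2 3 4 by (simp add: distrib_left add_divide_distrib)
qed

section \<open>Reindexing of truncated double sums and of the splittings\<close>

lemma sum_triangle_pairs:
  fixes E :: "nat \<Rightarrow> nat \<Rightarrow> complex"
  assumes "\<And>i j. i + j \<ge> N \<Longrightarrow> E i j = 0"
  shows "(\<Sum>i\<le>N. \<Sum>j\<le>N. f (i + j + 1) * E i j) = (\<Sum>k\<le>N. f k * (\<Sum>i<k. E i (k - 1 - i)))"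
proof -
  have "(\<Sum>i\<le>N. \<Sum>j\<le>N. f (i + j + 1) * E i j) = (\<Sum>(i, j)\<in>{..N} \<times> {..N}. f (i + j + 1) * E i j)"
    by (rule sum.cartesian_product)
  also have "\<dots> = (\<Sum>(i, j)\<in>{(i, j). i + j < N}. f (i + j + 1) * E i j)"
    by (rule sum.mono_neutral_right) (auto, metis assms not_le)
  also have "\<dots> = (\<Sum>(k, i)\<in>(SIGMA k:{..N}. {..<k}). f k * E i (k - 1 - i))"
    by (rule sum.reindex_bij_witness[of _ "\<lambda>(k, i). (i, k - 1 - i)" "\<lambda>(i, j). (i + j + 1, i)"]) auto
  also have "\<dots> = (\<Sum>k\<le>N. f k * (\<Sum>i<k. E i (k - 1 - i)))"
    by (simp add: sum.Sigma sum_distrib_left)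
  finally show ?thesis .
qed

text \<open>A Cauchy product with p = k + m; since \<open>X\<close> vanishes above \<open>N\<close>,
  the square and the triangle carry the same terms.\<close>

lemma sum_triangle_shift:
  fixes X :: "nat \<Rightarrow> complex"
  assumes "\<And>p. p > N \<Longrightarrow> X p = 0"
  shows "(\<Sum>k\<le>N. \<Sum>m\<le>N. a k * b m * X (k + m)) = (\<Sum>p\<le>N. (\<Sum>m\<le>p. a (p - m) * b m) * X p)"
proof -
  have "(\<Sum>k\<le>N. \<Sum>m\<le>N. a k * b m * X (k + m)) = (\<Sum>(k, m)\<in>{..N} \<times> {..N}. a k * b m * X (k + m))"
    by (rule sum.cartesian_product)
  also have "\<dots> = (\<Sum>(k, m)\<in>{(k, m). k + m \<le> N}. a k * b m * X (k + m))"
    by (rule sum.mono_neutral_right) (auto, metis assms not_le)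
  also have "\<dots> = (\<Sum>(p, m)\<in>(SIGMA p:{..N}. {..p}). a (p - m) * b m * X p)"
    by (rule sum.reindex_bij_witness[of _ "\<lambda>(p, m). (p - m, m)" "\<lambda>(k, m). (k + m, m)"]) auto
  also have "\<dots> = (\<Sum>p\<le>N. (\<Sum>m\<le>p. a (p - m) * b m) * X p)"
    by (simp add: sum.Sigma sum_distrib_right)
  finally show ?thesis .
qed

lemma split_sum_Pow:
  "split_sum h xs = (\<Sum>I\<in>Pow {..<length xs}. h (nths xs I) (nths xs ({..<length xs} - I)))"
proof (induction xs arbitrary: h)
  case (Cons x xs)
  let ?n = "length xs"
  let ?f = "\<lambda>I. h (nths (x # xs) I) (nths (x # xs) ({..<length (x # xs)} - I))"
  have *: "{j. Suc j \<in> {..<Suc ?n} - insert 0 (Suc ` I)} = {..<?n} - I"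
    "{j. Suc j \<in> {..<Suc ?n} - Suc ` I} = {..<?n} - I"
    "{j. j < ?n \<and> Suc j \<notin> Suc ` I} = {..<?n} - I"
    "{j. Suc j \<in> insert 0 (Suc ` I)} = I" "{j. Suc j \<in> Suc ` I} = I" for I
    by auto
  have inj: "inj_on ((`) Suc) A" "inj_on (\<lambda>I. insert 0 (Suc ` I)) A" for A
    by (auto simp: inj_on_def set_eq_iff image_iff)
  have "Pow {..<length (x # xs)} = (`) Suc ` Pow {..<?n} \<union> (\<lambda>I. insert 0 (Suc ` I)) ` Pow {..<?n}"
    by (simp add: lessThan_Suc_eq_insert_0 Pow_insert image_Pow_surj image_image[symmetric] Un_commute)
  hence "sum ?f (Pow {..<length (x # xs)}) =
      sum ?f ((`) Suc ` Pow {..<?n} \<union> (\<lambda>I. insert 0 (Suc ` I)) ` Pow {..<?n})"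
    by simp
  also have "\<dots> = sum ?f ((`) Suc ` Pow {..<?n}) + sum ?f ((\<lambda>I. insert 0 (Suc ` I)) ` Pow {..<?n})"
    by (intro sum.union_disjoint) auto
  also have "\<dots> = split_sum h (x # xs)"
    unfolding sum.reindex[OF inj(1)] sum.reindex[OF inj(2)]
    by (simp add: nths_Cons * Cons.IH add.commute)
  finally show ?case ..
qed simp

text \<open>A splitting is determined by \<open>(g1, I)\<close>. Excluding omega^0_1 becomes a
  default value 0, so that the sums run over full ranges.\<close>

lemma sum_splittings:
  "(\<Sum>(g1, I, g2, J)\<in>splittings g (length xs). f g1 (nths xs I) g2 (nths xs J)) =
     (\<Sum>g1\<le>g. split_sum (\<lambda>u v. if g1 = 0 \<and> u = [] \<or> g - g1 = 0 \<and> v = [] then 0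
        else f g1 u (g - g1) v) xs)"
proof -
  let ?U = "{..<length xs}"
  let ?P = "\<lambda>(g1, I). (g1, I) \<noteq> (0, {}) \<and> (g - g1, ?U - I) \<noteq> (0, {})"
  let ?F = "\<lambda>(g1, I). f g1 (nths xs I) (g - g1) (nths xs (?U - I))"
  have nil: "nths xs I = [] \<longleftrightarrow> I = {}" if "I \<subseteq> ?U" for I
  proof -
    have "{i. i < length xs \<and> i \<in> I} = I" using that by auto
    hence "length (nths xs I) = card I" by (simp add: length_nths)
    thus ?thesis using that finite_subset[OF that] by (metis card_0_eq finite_lessThan length_0_conv)
  qed
  have "(\<Sum>(g1, I, g2, J)\<in>splittings g (length xs). f g1 (nths xs I) g2 (nths xs J)) =
      sum ?F {p \<in> {..g} \<times> Pow ?U. ?P p}"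
  proof -
    let ?j = "\<lambda>(g1, I). (g1, I, g - g1, ?U - I)"
    have "splittings g (length xs) = ?j ` {p \<in> {..g} \<times> Pow ?U. ?P p}"
    proof (intro equalityI subsetI)
      fix q assume "q \<in> splittings g (length xs)"
      then obtain g1 I g2 J where q: "q = (g1, I, g2, J)" and
        s: "g1 + g2 = g" "I \<union> J = ?U" "I \<inter> J = {}" "(g1, I) \<noteq> (0, {})" "(g2, J) \<noteq> (0, {})"
        by (cases q) (simp add: splittings_def)
      have "g2 = g - g1" "J = ?U - I" "g1 \<le> g" "I \<subseteq> ?U"
        using s(1-3) by auto
      thus "q \<in> ?j ` {p \<in> {..g} \<times> Pow ?U. ?P p}"
        using q s(4,5) by (intro image_eqI[of _ _ "(g1, I)"]) simp_all
    next
      fix q assume "q \<in> ?j ` {p \<in> {..g} \<times> Pow ?U. ?P p}"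
      then obtain p where p: "q = ?j p" "p \<in> {p \<in> {..g} \<times> Pow ?U. ?P p}"
        by (rule imageE)
      obtain g1 I where gI: "p = (g1, I)" by (cases p)
      have q: "q = (g1, I, g - g1, ?U - I)" "g1 \<le> g" "I \<subseteq> ?U"
          "(g1, I) \<noteq> (0, {})" "(g - g1, ?U - I) \<noteq> (0, {})"
        using p by (simp_all add: gI)
      have "g1 + (g - g1) = g" "I \<union> (?U - I) = ?U" "I \<inter> (?U - I) = {}"
        using q(2,3) by auto
      thus "q \<in> splittings g (length xs)"
        using q(4,5) unfolding splittings_def q(1) mem_Collect_eq prod.case by (intro conjI)
    qed
    moreover have "inj_on ?j {p \<in> {..g} \<times> Pow ?U. ?P p}"
      by (rule inj_onI) (simp split: prod.splits)
    ultimately have "(\<Sum>(g1, I, g2, J)\<in>splittings g (length xs). f g1 (nths xs I) g2 (nths xs J)) =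
        sum ((\<lambda>(g1, I, g2, J). f g1 (nths xs I) g2 (nths xs J)) \<circ> ?j) {p \<in> {..g} \<times> Pow ?U. ?P p}"
      by (simp only: sum.reindex)
    thus ?thesis
      by (simp only: comp_def case_prod_beta' prod.sel)
  qed
  also have "\<dots> = (\<Sum>p\<in>{..g} \<times> Pow ?U. if ?P p then ?F p else 0)"
    by (intro sum.inter_filter) simp
  also have "\<dots> = (\<Sum>g1\<le>g. \<Sum>I\<in>Pow ?U. if ?P (g1, I) then ?F (g1, I) else 0)"
    unfolding sum.cartesian_product
  proof (rule sum.cong[OF refl])
    fix p show "(if ?P p then ?F p else 0) = (case p of (g1, I) \<Rightarrow> if ?P (g1, I) then ?F (g1, I) else 0)"
      by (cases p) (simp only: prod.case)
  qed
  also have "\<dots> = (\<Sum>g1\<le>g. split_sum (\<lambda>u v. if g1 = 0 \<and> u = [] \<or> g - g1 = 0 \<and> v = [] then 0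
        else f g1 u (g - g1) v) xs)"
    unfolding split_sum_Pow by (intro sum.cong refl) (auto simp: nil)
  finally show ?thesis .
qed

section \<open>Identification of the invariants with the correlators\<close>

abbreviation bessel_TR :: "nat \<Rightarrow> complex \<Rightarrow> complex list \<Rightarrow> complex" where
  "bessel_TR \<equiv> TR (\<lambda>z. z\<^sup>2) (\<lambda>z. 1 / z)"

text \<open>The involution is known only as a germ, which suffices inside a residue. The minus sign
  of the kernel cancels against the derivative -1 of the involution.\<close>

lemma bessel_TR_recursion:
  assumes "g > 0 \<or> length zs \<ge> 2" "z1 \<noteq> 0"
    and "has_residue (\<lambda>z. z / (4 * (z1\<^sup>2 - z\<^sup>2)) *
      ((if g = 0 then 0 else bessel_TR (g - 1) z (- z # zs)) +
       (\<Sum>g1\<le>g. split_sum (\<lambda>u v. if g1 = 0 \<and> u = [] \<or> g - g1 = 0 \<and> v = [] then 0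
          else bessel_TR g1 z u * bessel_TR (g - g1) (- z) v) zs))) r"
  shows "bessel_TR g z1 zs = r"
proof -
  define s where "s = local_involution (\<lambda>z. z\<^sup>2) 0"
  define B where "B = (\<lambda>z s. (if g = 0 then 0 else bessel_TR (g - 1) z (s # zs)) +
       (\<Sum>(g1, I, g2, J)\<in>splittings g (length zs). bessel_TR g1 z (nths zs I) * bessel_TR g2 s (nths zs J)))"
  have "bessel_TR g z1 zs =
     residue (\<lambda>z. recursion_kernel (\<lambda>z. z\<^sup>2) (\<lambda>z. 1 / z) s z1 z * B z (s z) * deriv s z) 0"
  proof -
    have "\<not> (g = 0 \<and> length zs = 0)" "\<not> (g = 0 \<and> length zs = 1)"
      using assms(1) by auto
    thus ?thesis
      unfolding TR.simps[of _ _ g z1 zs] ramification_points_square s_def B_def by (simp only: if_False) simp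
  qed
  also have "\<dots> = residue (\<lambda>z. z / (4 * (z1\<^sup>2 - z\<^sup>2)) * B z (- z)) 0"
  proof (rule residue_cong)
    have "s 0 = 0"
      using local_involution_square(1) by (simp add: is_local_involution_def s_def)
    hence "\<forall>\<^sub>F z in nhds 0. s z = - z"
      using local_involution_square(2) by (simp add: s_def eventually_nhds_conv_at)
    \<comment> \<open>\<open>deriv s z\<close> depends on \<open>s\<close> in a neighbourhood of
      \<open>z\<close>, hence the nested eventuality; \<open>s 0 = 0\<close> fills the
      puncture.\<close>
    hence ev: "\<forall>\<^sub>F z in nhds 0. \<forall>\<^sub>F w in nhds z. s w = - w"
      by (simp add: eventually_eventually)
    have "\<forall>\<^sub>F z in at 0. \<forall>\<^sub>F w in nhds z. s w = - w"
      using ev by (simp add: eventually_nhds_conv_at)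
    moreover have "\<forall>\<^sub>F z in at (0::complex). z \<noteq> 0" "\<forall>\<^sub>F z in at (0::complex). z \<noteq> z1"
      "\<forall>\<^sub>F z in at (0::complex). z \<noteq> - z1"
      by (rule eventually_neq_at_within)+
    ultimately show "\<forall>\<^sub>F z in at 0. recursion_kernel (\<lambda>z. z\<^sup>2) (\<lambda>z. 1 / z) s z1 z * B z (s z) * deriv s z =
        z / (4 * (z1\<^sup>2 - z\<^sup>2)) * B z (- z)"
    proof eventually_elim
      case (elim z)
      have sz: "s z = - z"
        using elim(1) by (rule eventually_nhds_x_imp_x)
      have ds: "deriv s z = - 1"
        using deriv_cong_ev[OF elim(1) refl] by simp
      have dx: "deriv (\<lambda>z. z\<^sup>2) z = 2 * z"
        by (rule DERIV_imp_deriv) (auto intro!: derivative_eq_intros)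
      have ne: "z - z1 \<noteq> 0" "- z - z1 \<noteq> 0" "z1\<^sup>2 - z\<^sup>2 = (z - z1) * (- z - z1)"
        using elim by (auto simp: power2_eq_square algebra_simps add_eq_0_iff2)
      have "recursion_kernel (\<lambda>z. z\<^sup>2) (\<lambda>z. 1 / z) s z1 z = - (z / (4 * (z1\<^sup>2 - z\<^sup>2)))"
        unfolding recursion_kernel_def sz dx ne(3) using ne(1,2) elim(2)
        by (simp add: divide_simps)
      thus ?case by (simp add: sz ds)
    qed
  qed simp
  also have "\<dots> = r"
    unfolding B_def sum_splittings[of "\<lambda>g1 u g2 v. bessel_TR g1 _ u * bessel_TR g2 _ v"]
    by (rule has_residue_imp_residue[OF assms(3)])
  finally show ?thesis .
qed

text \<open>Both claims share one induction because the vanishing in genus 0 removes most splittings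
  in positive genus.\<close>

lemma bessel_TR_expand:
  assumes "g \<le> N" "z1 \<noteq> 0" "0 \<notin> set zs"
  shows "(g = 0 \<longrightarrow> length zs \<ge> 2 \<longrightarrow> bessel_TR g z1 zs = 0) \<and>
         (g > 0 \<longrightarrow> bessel_TR g z1 zs = expand N (corr g) (z1 # zs))"
  using assms
proof (induction "2 * g + length zs" arbitrary: g z1 zs rule: less_induct)
  case less
  have IH0: "bessel_TR 0 z u = 0"
    if "length u < 2 * g + length zs" "length u \<ge> 2" "z \<noteq> 0" "0 \<notin> set u" for z u
    using less.hyps[of 0 u z] that by simp
  have IH: "bessel_TR h z u = expand N (corr h) (z # u)"
    if "2 * h + length u < 2 * g + length zs" "h > 0" "h \<le> g" "z \<noteq> 0" "0 \<notin> set u" for h z u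
    using less.hyps[of h u z] that less.prems by simp
  have nz: "0 \<notin> set u" "0 \<notin> set v" if "(u, v) \<in> set (splits zs)" for u v
    using splits_set[OF that] less.prems by auto
  \<comment> \<open>By induction only products of two omega^0_2 remain, and times the kernel these
    are analytic at 0.\<close>
  have zero: "bessel_TR g z1 zs = 0" if "g = 0" "length zs \<ge> 2"
  proof (rule bessel_TR_recursion)
    have "has_residue (\<lambda>z. split_sum (\<lambda>u v. z / (4 * (z1\<^sup>2 - z\<^sup>2)) *
        (if u = [] \<or> v = [] then 0 else bessel_TR 0 z u * bessel_TR 0 (- z) v)) zs)
        (split_sum (\<lambda>u v. 0) zs)"
    proof (rule has_residue_split_sum)
      fix u v assume uv: "(u, v) \<in> set (splits zs)"
      note len = splits_length[OF uv]
      have ev: "\<forall>\<^sub>F z in at (0::complex). z \<noteq> 0" by (rule eventually_neq_at_within)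
      consider "u = [] \<or> v = []" | "u \<noteq> []" "v \<noteq> []" "length u \<ge> 2 \<or> length v \<ge> 2"
        | a b where "u = [a]" "v = [b]"
        by (cases u rule: remdups_adj.cases; cases v rule: remdups_adj.cases) auto
      thus "has_residue (\<lambda>z. z / (4 * (z1\<^sup>2 - z\<^sup>2)) *
          (if u = [] \<or> v = [] then 0 else bessel_TR 0 z u * bessel_TR 0 (- z) v)) 0"
      proof cases
        case 1
        thus ?thesis by (auto simp: has_residue_0)
      next
        case 2
        have "\<forall>\<^sub>F z in at 0. z / (4 * (z1\<^sup>2 - z\<^sup>2)) *
          (if u = [] \<or> v = [] then 0 else bessel_TR 0 z u * bessel_TR 0 (- z) v) = 0"
          using ev
        proof eventually_elim
          case (elim z)
          have "length u < length zs" "length v < length zs"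
            using len 2 by auto
          thus ?case using 2(3) IH0[of u z] IH0[of v "- z"] nz[OF uv] elim by auto
        qed
        thus ?thesis by (rule has_residue_cong[OF has_residue_0])
      next
        case 3
        have "a \<noteq> 0" "b \<noteq> 0" using nz[OF uv] 3 by auto
        have "(\<lambda>z. z / (4 * (z1\<^sup>2 - z\<^sup>2)) * (1 / (z - a)\<^sup>2 * (1 / (- z - b)\<^sup>2))) analytic_on {0}"
          using \<open>a \<noteq> 0\<close> \<open>b \<noteq> 0\<close> less.prems by (auto intro!: analytic_intros)
        thus ?thesis by (simp add: 3 TR.simps[of _ _ _ _ "[_]"] has_residue_analytic)
      qed
    qed
    moreover have sum0: "(\<Sum>k\<le>0. h k) = h 0" for h :: "nat \<Rightarrow> complex"
      by simp
    ultimately show "has_residue (\<lambda>z. z / (4 * (z1\<^sup>2 - z\<^sup>2)) *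
      ((if g = 0 then 0 else bessel_TR (g - 1) z (- z # zs)) +
       (\<Sum>g1\<le>g. split_sum (\<lambda>u v. if g1 = 0 \<and> u = [] \<or> g - g1 = 0 \<and> v = [] then 0
          else bessel_TR g1 z u * bessel_TR (g - g1) (- z) v) zs))) 0"
      using sum0 by (simp only: that(1) split_sum_cmult split_sum_zero diff_0_eq_0 simp_thms if_True add_0)
  qed (use that less.prems in auto)
  have pos: "bessel_TR g z1 zs = expand N (corr g) (z1 # zs)" if g: "g > 0"
  proof -
    define X where "X = (\<lambda>p v. expand N (\<lambda>ks. corr g (p # ks)) v)"
    define E where "E = (\<lambda>i j. expand N (corr_pair g i j) zs)"
    \<comment> \<open>This is omega^0_2(z, -z) = 1 / (2 z)^2; the kernel contributes another 1/4,
      which gives the 1/16 of \<open>corr_Cons\<close>.\<close>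
    define \<delta> where "\<delta> = (if g = 1 \<and> zs = [] then 1 / 4 else 0 :: complex)"
    define w where "w = (\<lambda>m. 2 * (2 * of_nat m + 1) :: complex)"
    let ?q = "\<lambda>z p. (1 / z\<^sup>2) ^ Suc p :: complex"
    have A: "bessel_TR (g - 1) z (- z # zs) =
        (\<Sum>i\<le>N. \<Sum>j\<le>N. ?q z (i + j + 1) * expand N (\<lambda>ks. corr (g - 1) (i # j # ks)) zs) + \<delta> * ?q z 0"
      if z: "z \<noteq> 0" for z
    proof (cases "g = 1")
      case True
      have "corr 0 = (\<lambda>ks. 0)" by (simp add: corr_def fun_eq_iff)
      hence "(\<Sum>i\<le>N. \<Sum>j\<le>N. ?q z (i + j + 1) * expand N (\<lambda>ks. corr (g - 1) (i # j # ks)) zs) = 0"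
        using True by simp
      moreover have "bessel_TR (g - 1) z (- z # zs) = \<delta> * ?q z 0"
      proof (cases "zs = []")
        case True
        thus ?thesis using \<open>g = 1\<close>
          by (simp add: \<delta>_def TR.simps[of _ _ _ _ "[_]"] power_mult_distrib flip: mult_2)
      next
        case False
        thus ?thesis using IH0[of "- z # zs" z] z less.prems \<open>g = 1\<close>
          by (cases zs) (auto simp: \<delta>_def)
      qed
      ultimately show ?thesis by simp
    next
      case False
      have "bessel_TR (g - 1) z (- z # zs) = expand N (corr (g - 1)) (z # - z # zs)"
        using g False z less.prems by (intro IH) auto
      also have "\<dots> = (\<Sum>i\<le>N. \<Sum>j\<le>N. ?q z (i + j + 1) * expand N (\<lambda>ks. corr (g - 1) (i # j # ks)) zs)"
        by (simp add: sum_distrib_left power_add mult_ac)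
      finally show ?thesis using False by (simp add: \<delta>_def)
    qed
    have B: "split_sum (\<lambda>u v. if g1 = 0 \<and> u = [] \<or> g - g1 = 0 \<and> v = [] then 0
          else bessel_TR g1 z u * bessel_TR (g - g1) (- z) v) zs =
        (\<Sum>i\<le>N. \<Sum>j\<le>N. ?q z (i + j + 1) *
          expand N (split_sum (\<lambda>u v. corr g1 (i # u) * corr (g - g1) (j # v))) zs)"
      if z: "z \<noteq> 0" and g1: "g1 \<in> {1..<g}" for z g1
    proof -
      have "split_sum (\<lambda>u v. if g1 = 0 \<and> u = [] \<or> g - g1 = 0 \<and> v = [] then 0
          else bessel_TR g1 z u * bessel_TR (g - g1) (- z) v) zs =
        split_sum (\<lambda>u v. expand N (corr g1) (z # u) * expand N (corr (g - g1)) (z # v)) zs"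
      proof (rule split_sum_cong)
        fix u v assume uv: "(u, v) \<in> set (splits zs)"
        have "bessel_TR g1 z u = expand N (corr g1) (z # u)"
          using g1 z nz[OF uv] splits_length[OF uv] by (intro IH) auto
        moreover have "bessel_TR (g - g1) (- z) v = expand N (corr (g - g1)) (- z # v)"
          using g1 z nz[OF uv] splits_length[OF uv] by (intro IH) auto
        moreover have "g1 \<noteq> 0" "g - g1 \<noteq> 0"
          using g1 by auto
        ultimately show "(if g1 = 0 \<and> u = [] \<or> g - g1 = 0 \<and> v = [] then 0
          else bessel_TR g1 z u * bessel_TR (g - g1) (- z) v) =
          expand N (corr g1) (z # u) * expand N (corr (g - g1)) (z # v)"
          by (simp only: expand_uminus simp_thms if_False)
      qed
      also have "\<dots> = (\<Sum>i\<le>N. \<Sum>j\<le>N. split_sum (\<lambda>u v. ?q z (i + j + 1) *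
          (expand N (\<lambda>ks. corr g1 (i # ks)) u * expand N (\<lambda>ks. corr (g - g1) (j # ks)) v)) zs)"
        unfolding split_sum_sum[symmetric] expand.simps sum_product
        by (intro split_sum_cong sum.cong refl) (simp add: power_add mult_ac)
      also have "\<dots> = (\<Sum>i\<le>N. \<Sum>j\<le>N. ?q z (i + j + 1) *
          expand N (split_sum (\<lambda>u v. corr g1 (i # u) * corr (g - g1) (j # v))) zs)"
        by (simp only: split_sum_cmult expand_split_sum)
      finally show ?thesis .
    qed
    have C0: "split_sum (\<lambda>u v. if u = [] then 0 else bessel_TR 0 z u * bessel_TR g z' v) zs =
        pick_sum (\<lambda>w v. 1 / (z - w)\<^sup>2 * expand N (corr g) (z' # v)) zs"
      if z: "z \<noteq> 0" "z' \<noteq> 0" for z z'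
    proof -
      let ?h = "\<lambda>u v. if length u = 1 then 1 / (z - hd u)\<^sup>2 * expand N (corr g) (z' # v) else 0"
      have "split_sum (\<lambda>u v. if u = [] then 0 else bessel_TR 0 z u * bessel_TR g z' v) zs = split_sum ?h zs"
      proof (rule split_sum_cong)
        fix u v assume uv: "(u, v) \<in> set (splits zs)"
        note len = splits_length[OF uv]
        consider "u = []" | a where "u = [a]" | "length u \<ge> 2"
          by (cases u rule: remdups_adj.cases) auto
        thus "(if u = [] then 0 else bessel_TR 0 z u * bessel_TR g z' v) = ?h u v"
        proof cases
          case 2
          have "bessel_TR g z' v = expand N (corr g) (z' # v)"
            using 2 len g z nz[OF uv] by (intro IH) auto
          thus ?thesis using 2 by (simp add: TR.simps[of _ _ _ _ "[_]"] del: expand.simps)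
        next
          case 3
          have "bessel_TR 0 z u = 0"
            using 3 len g z nz[OF uv] by (intro IH0) auto
          thus ?thesis using 3 by auto
        qed simp
      qed
      also have "\<dots> = pick_sum (\<lambda>w v. 1 / (z - w)\<^sup>2 * expand N (corr g) (z' # v)) zs"
        by (subst split_sum_singleton_left) (simp_all del: expand.simps)
      finally show ?thesis .
    qed
    \<comment> \<open>These are the two extreme distributions of the genus. The factor of genus
      \<open>g\<close> is even in \<open>z\<close>, so the two values of omega^0_2 add up to the
      function in \<open>has_residue_kernel_omega02\<close>.\<close>
    have C: "split_sum (\<lambda>u v. if u = [] then 0 else bessel_TR 0 z u * bessel_TR g (- z) v) zs +
        split_sum (\<lambda>u v. if v = [] then 0 else bessel_TR g z u * bessel_TR 0 (- z) v) zs =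
        pick_sum (\<lambda>w v. \<Sum>p\<le>N. X p v * ((1 / (z - w)\<^sup>2 + 1 / (- z - w)\<^sup>2) * ?q z p)) zs"
      if z: "z \<noteq> 0" for z
    proof -
      have 1: "split_sum (\<lambda>u v. if u = [] then 0 else bessel_TR 0 z u * bessel_TR g (- z) v) zs =
        pick_sum (\<lambda>w v. 1 / (z - w)\<^sup>2 * expand N (corr g) (- z # v)) zs"
        by (rule C0) (use z in auto)
      have "split_sum (\<lambda>u v. if v = [] then 0 else bessel_TR g z u * bessel_TR 0 (- z) v) zs =
        split_sum (\<lambda>u v. if u = [] then 0 else bessel_TR 0 (- z) u * bessel_TR g z v) zs"
        by (subst split_sum_commute) (simp only: mult.commute)
      also have "\<dots> = pick_sum (\<lambda>w v. 1 / (- z - w)\<^sup>2 * expand N (corr g) (z # v)) zs"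
        by (rule C0) (use z in auto)
      finally have 2: "split_sum (\<lambda>u v. if v = [] then 0 else bessel_TR g z u * bessel_TR 0 (- z) v) zs = \<dots>" .
      show ?thesis
        unfolding 1 2 expand_uminus pick_sum_add[symmetric] X_def
        by (simp only: expand.simps sum_distrib_left sum.distrib[symmetric] distrib_left distrib_right mult_ac)
    qed
    have bracket: "(if g = 0 then 0 else bessel_TR (g - 1) z (- z # zs)) +
       (\<Sum>g1\<le>g. split_sum (\<lambda>u v. if g1 = 0 \<and> u = [] \<or> g - g1 = 0 \<and> v = [] then 0
          else bessel_TR g1 z u * bessel_TR (g - g1) (- z) v) zs) =
       (\<Sum>i\<le>N. \<Sum>j\<le>N. E i j * ?q z (i + j + 1)) + \<delta> * ?q z 0 +
       pick_sum (\<lambda>w v. \<Sum>p\<le>N. X p v * ((1 / (z - w)\<^sup>2 + 1 / (- z - w)\<^sup>2) * ?q z p)) zs"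
      if z: "z \<noteq> 0" for z
    proof -
      let ?T = "\<lambda>g1. split_sum (\<lambda>u v. if g1 = 0 \<and> u = [] \<or> g - g1 = 0 \<and> v = [] then 0
          else bessel_TR g1 z u * bessel_TR (g - g1) (- z) v) zs"
      have "{..g} = insert 0 (insert g {1..<g})" using g by auto
      hence "(\<Sum>g1\<le>g. ?T g1) = (\<Sum>g1\<in>{1..<g}. ?T g1) + (?T 0 + ?T g)"
        using g by simp
      also have "?T 0 + ?T g = pick_sum (\<lambda>w v. \<Sum>p\<le>N. X p v * ((1 / (z - w)\<^sup>2 + 1 / (- z - w)\<^sup>2) * ?q z p)) zs"
        using g C[OF z] by (simp cong: if_cong)
      also have "(\<Sum>g1\<in>{1..<g}. ?T g1) = (\<Sum>g1\<in>{1..<g}. \<Sum>i\<le>N. \<Sum>j\<le>N. ?q z (i + j + 1) *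
          expand N (split_sum (\<lambda>u v. corr g1 (i # u) * corr (g - g1) (j # v))) zs)"
        by (intro sum.cong refl B z)
      also have "\<dots> = (\<Sum>i\<le>N. \<Sum>j\<le>N. \<Sum>g1\<in>{1..<g}. ?q z (i + j + 1) *
          expand N (split_sum (\<lambda>u v. corr g1 (i # u) * corr (g - g1) (j # v))) zs)"
        by (subst sum.swap) (intro sum.cong refl sum.swap)
      \<comment> \<open>\<open>E\<close> contains the term of genus \<open>g - 1\<close> as well; it
        is subtracted here and supplied by \<open>A\<close>.\<close>
      also have "\<dots> = (\<Sum>i\<le>N. \<Sum>j\<le>N. ?q z (i + j + 1) *
          (E i j - expand N (\<lambda>ks. corr (g - 1) (i # j # ks)) zs))"
        unfolding E_def corr_pair_def[abs_def] expand_add expand_sum by (simp add: sum_distrib_left)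
      finally have sum_eq: "(\<Sum>g1\<le>g. ?T g1) = (\<Sum>i\<le>N. \<Sum>j\<le>N. ?q z (i + j + 1) *
          (E i j - expand N (\<lambda>ks. corr (g - 1) (i # j # ks)) zs)) +
          pick_sum (\<lambda>w v. \<Sum>p\<le>N. X p v * ((1 / (z - w)\<^sup>2 + 1 / (- z - w)\<^sup>2) * ?q z p)) zs" .
      have "(\<Sum>i\<le>N. \<Sum>j\<le>N. E i j * ?q z (i + j + 1)) =
          (\<Sum>i\<le>N. \<Sum>j\<le>N. ?q z (i + j + 1) * expand N (\<lambda>ks. corr (g - 1) (i # j # ks)) zs) +
          (\<Sum>i\<le>N. \<Sum>j\<le>N. ?q z (i + j + 1) *
            (E i j - expand N (\<lambda>ks. corr (g - 1) (i # j # ks)) zs))"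
        unfolding sum.distrib[symmetric] distrib_left[symmetric]
        by (intro sum.cong refl) (simp add: mult.commute)
      moreover have "g \<noteq> 0" using g by simp
      ultimately show ?thesis
        unfolding sum_eq A[OF z] by (simp only: if_False add_ac)
    qed
    have res: "bessel_TR g z1 zs = (\<Sum>i\<le>N. \<Sum>j\<le>N. E i j * (1 / 4 * ?q z1 (i + j + 1))) + \<delta> * (1 / 4 * ?q z1 0) +
       pick_sum (\<lambda>a v. \<Sum>p\<le>N. X p v * ((\<Sum>m\<le>p. ?q z1 (p - m) * (w m * ?q a m)) / 4)) zs"
    proof (rule bessel_TR_recursion)
      let ?K = "\<lambda>z. z / (4 * (z1\<^sup>2 - z\<^sup>2))"
      have "has_residue (\<lambda>z. (\<Sum>i\<le>N. \<Sum>j\<le>N. E i j * (?K z * ?q z (i + j + 1))) + \<delta> * (?K z * ?q z 0) +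
          pick_sum (\<lambda>w v. \<Sum>p\<le>N. X p v * (?K z * ((1 / (z - w)\<^sup>2 + 1 / (- z - w)\<^sup>2) * ?q z p))) zs)
        ((\<Sum>i\<le>N. \<Sum>j\<le>N. E i j * (1 / 4 * ?q z1 (i + j + 1))) + \<delta> * (1 / 4 * ?q z1 0) +
       pick_sum (\<lambda>a v. \<Sum>p\<le>N. X p v * ((\<Sum>m\<le>p. ?q z1 (p - m) * (w m * ?q a m)) / 4)) zs)"
      proof (intro has_residue_add has_residue_sum has_residue_cmult has_residue_pick_sum has_residue_kernel_power)
        fix a v p assume "(a, v) \<in> set (picks zs)"
        from picks_mset[OF this] have "a \<in> set zs"
          by (metis set_mset_mset union_single_eq_member)
        hence "a \<noteq> 0" using less.prems by auto
        thus "has_residue (\<lambda>z. ?K z * ((1 / (z - a)\<^sup>2 + 1 / (- z - a)\<^sup>2) * ?q z p))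
            ((\<Sum>m\<le>p. ?q z1 (p - m) * (w m * ?q a m)) / 4)"
          unfolding w_def using less.prems by (intro has_residue_kernel_omega02)
      qed (use less.prems in auto)
      moreover have "\<forall>\<^sub>F z in at 0. ?K z * ((if g = 0 then 0 else bessel_TR (g - 1) z (- z # zs)) +
       (\<Sum>g1\<le>g. split_sum (\<lambda>u v. if g1 = 0 \<and> u = [] \<or> g - g1 = 0 \<and> v = [] then 0
          else bessel_TR g1 z u * bessel_TR (g - g1) (- z) v) zs)) =
        (\<Sum>i\<le>N. \<Sum>j\<le>N. E i j * (?K z * ?q z (i + j + 1))) + \<delta> * (?K z * ?q z 0) +
          pick_sum (\<lambda>w v. \<Sum>p\<le>N. X p v * (?K z * ((1 / (z - w)\<^sup>2 + 1 / (- z - w)\<^sup>2) * ?q z p))) zs"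
        using eventually_neq_at_within[of "0::complex" 0 UNIV]
      proof eventually_elim
        case (elim z)
        show ?case
          unfolding bracket[OF elim] distrib_left sum_distrib_left pick_sum_cmult[symmetric]
          by (simp only: mult.left_commute)
      qed
      ultimately show "has_residue (\<lambda>z. ?K z * ((if g = 0 then 0 else bessel_TR (g - 1) z (- z # zs)) +
       (\<Sum>g1\<le>g. split_sum (\<lambda>u v. if g1 = 0 \<and> u = [] \<or> g - g1 = 0 \<and> v = [] then 0
          else bessel_TR g1 z u * bessel_TR (g - g1) (- z) v) zs)))
        ((\<Sum>i\<le>N. \<Sum>j\<le>N. E i j * (1 / 4 * ?q z1 (i + j + 1))) + \<delta> * (1 / 4 * ?q z1 0) +
       pick_sum (\<lambda>a v. \<Sum>p\<le>N. X p v * ((\<Sum>m\<le>p. ?q z1 (p - m) * (w m * ?q a m)) / 4)) zs)"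
        by (rule has_residue_cong)
    qed (use g less.prems in auto)
    \<comment> \<open>The expression in \<open>res\<close> is now reached from the coefficients,
      through \<open>corr_Cons\<close>.\<close>
    have "expand N (corr g) (z1 # zs) = (\<Sum>k\<le>N. ?q z1 k *
       (1 / 4 * (\<Sum>i<k. E i (k - 1 - i)) + 1 / 4 * pick_sum (\<lambda>a v. \<Sum>m\<le>N. ?q a m * (w m * X (k + m) v)) zs +
        (if k = 0 then \<delta> / 4 else 0)))"
    proof -
      have "expand N (\<lambda>ks. corr g (k # ks)) zs =
        1 / 4 * (\<Sum>i<k. E i (k - 1 - i)) + 1 / 4 * pick_sum (\<lambda>a v. \<Sum>m\<le>N. ?q a m * (w m * X (k + m) v)) zs +
        (if k = 0 then \<delta> / 4 else 0)" for k
      proof -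
        have "(\<lambda>ks. corr g (k # ks)) = (\<lambda>ks. 1 / 4 * (\<Sum>i<k. corr_pair g i (k - 1 - i) ks) +
          1 / 4 * pick_sum (\<lambda>a v. w a * corr g ((k + a) # v)) ks +
          (if (g = 1 \<and> k = 0) \<and> ks = [] then 1 / 16 else 0))"
          unfolding w_def by (rule ext, subst corr_Cons) (simp add: add_divide_distrib)
        thus ?thesis
          by (simp only: expand_add expand_cmult expand_sum expand_Nil_indicator expand_pick_sum E_def X_def)
             (simp add: \<delta>_def)
      qed
      thus ?thesis by simp
    qed
    also have "\<dots> = 1 / 4 * (\<Sum>k\<le>N. ?q z1 k * (\<Sum>i<k. E i (k - 1 - i))) +
       1 / 4 * (\<Sum>k\<le>N. ?q z1 k * pick_sum (\<lambda>a v. \<Sum>m\<le>N. ?q a m * (w m * X (k + m) v)) zs) +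
       (\<Sum>k\<le>N. if k = 0 then ?q z1 0 * (\<delta> / 4) else 0)"
      unfolding sum_distrib_left[where A = "{..N}"] sum.distrib[symmetric]
      by (intro sum.cong refl) (simp add: algebra_simps)
    also have "(\<Sum>k\<le>N. ?q z1 k * (\<Sum>i<k. E i (k - 1 - i))) = (\<Sum>i\<le>N. \<Sum>j\<le>N. ?q z1 (i + j + 1) * E i j)"
    proof (rule sum_triangle_pairs[symmetric])
      fix i j assume "N \<le> i + j"
      hence "corr_pair g i j = (\<lambda>ks. 0)"
        using less.prems by (auto simp: corr_pair_eq fun_eq_iff)
      thus "E i j = 0" by (simp add: E_def)
    qed
    also have "(\<Sum>k\<le>N. ?q z1 k * pick_sum (\<lambda>a v. \<Sum>m\<le>N. ?q a m * (w m * X (k + m) v)) zs) =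
        pick_sum (\<lambda>a v. \<Sum>k\<le>N. \<Sum>m\<le>N. ?q z1 k * (w m * ?q a m) * X (k + m) v) zs"
      unfolding pick_sum_cmult[symmetric] pick_sum_sum[symmetric] sum_distrib_left by (simp only: mult_ac)
    also have "\<dots> = pick_sum (\<lambda>a v. \<Sum>p\<le>N. (\<Sum>m\<le>p. ?q z1 (p - m) * (w m * ?q a m)) * X p v) zs"
    proof (intro pick_sum_cong sum_triangle_shift)
      fix p v assume "N < p"
      hence "(\<lambda>ks. corr g (p # ks)) = (\<lambda>ks. 0)"
        using less.prems by (auto simp: corr_def fun_eq_iff)
      thus "X p v = 0" by (simp add: X_def)
    qed
    also have "(\<Sum>k\<le>N. if k = 0 then ?q z1 0 * (\<delta> / 4) else 0) = \<delta> * (1 / 4 * ?q z1 0)"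
      by simp
    finally show ?thesis
      unfolding res pick_sum_cmult[symmetric] sum_distrib_left by (simp add: mult_ac)
  qed
  show ?case using zero pos by blast
qed

theorem theorem3:
  fixes g :: nat and z :: complex
  assumes "z \<noteq> 0"
  shows "TR (\<lambda>z. z\<^sup>2) (\<lambda>z. 1 / z) g z [] =
    2 powi (1 - 8 * int g) * (fact (2 * g) ^ 3 / (fact g ^ 4 * (2 * of_nat g - 1))) *
    z powi (- 2 * int g)"
proof (cases g)
  case 0
  \<comment> \<open>In genus 0 the factor 2 g - 1 equals -1 and yields the sign of -y dx.\<close>
  have "deriv (\<lambda>z. z\<^sup>2) z = 2 * z"
    by (rule DERIV_imp_deriv) (auto intro!: derivative_eq_intros)
  thus ?thesis using 0 assms by (subst TR.simps) simp
next
  case (Suc k)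
  have "bessel_TR g z [] = expand g (corr g) [z]"
    using bessel_TR_expand[of g g z "[]"] assms Suc by simp
  also have "\<dots> = (\<Sum>m\<le>g. if k = m then (1 / z\<^sup>2) ^ Suc m * conn [m] else 0)"
    unfolding expand.simps by (intro sum.cong refl) (simp add: corr_def Suc)
  also have "\<dots> = (1 / z\<^sup>2) ^ g * conn [k]"
    by (subst sum.delta') (auto simp: Suc)
  also have "(1 / z\<^sup>2) ^ g = z powi (- 2 * int g)"
  proof -
    have "- 2 * int g = - int (2 * g)" by simp
    thus ?thesis
      by (simp only: power_int_minus power_int_of_nat power_one_over power_mult inverse_eq_divide)
  qed
  also have "conn [k] = disc [k]"
    by (simp add: disc_Cons)
  finally show ?thesis
    by (simp only: disc_one_point Suc mult.commute)
qed

end
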